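(* Let $X_1,X_2,\dots$ be i.i.d. random variables whose distribution function is Pareto, $F(x)=1-x^{-\lambda}$ for $x\ge 1$, for some $\lambda>0$ (the null hypothesis $H_0$). Then, as $n\to\infty$, $$\sqrt n\, I_n^{(4)}\ \xrightarrow{d}\ \mathcal N\!\left(0,\tfrac{271}{2100}\right).$$
   Context: For $n\ge 4$ and $t\ge 1$, let $$H_n(t)=\binom{n}{4}^{-1}\sum_{1\le i_1<i_2<i_3<i_4\le n}\mathbf 1\{X_{(4,\{i_1,\dots,i_4\})}/X_{(3,\{i_1,\dots,i_4\})}<t\},$$ where $X_{(s,\{i_1,\dots,i_4\})}$ is the $s$-th order statistic (in increasing order) of the subsample $X_{i_1},\dots,X_{i_4}$. Let $F_n(t)=n^{-1}\sum_{i=1}^n\mathbf 1(X_i<t)$ be the empirical distribution function. The statistic is $$I_n^{(4)}=\int_1^\infty (H_n(t)-F_n(t))\,dF_n(t)=\frac1n\sum_{i=1}^n\bigl(H_n(X_i)-F_n(X_i)\bigr).$$ $\mathcal N(0,\sigma^2)$ denotes the normal law with mean $0$ and variance $\sigma^2$, and $\xrightarrow{d}$ denotes convergence in distribution. *)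

theory Defs
  imports "HOL-Probability.Probability"
begin

text \<open>
  Samples are indexed from 0: \<open>x i\<close> stands for \<open>X\<^sub>i\<^sub>+\<^sub>1\<close>, so a sample of
  size \<open>n\<close> is \<open>x\<close> restricted to \<open>{..<n}\<close>.
\<close>

text \<open>Order statistics are numbered from 1, and ties are repeated according to multiplicity.\<close>

definition order_statistic :: "nat \<Rightarrow> nat set \<Rightarrow> (nat \<Rightarrow> real) \<Rightarrow> real" where
  "order_statistic s J x = sorted_list_of_multiset (image_mset x (mset_set J)) ! (s - 1)"

text \<open>The 4-element sets \<open>J \<subseteq> {..<n}\<close> are the index tuples \<open>i\<^sub>1 < i\<^sub>2 < i\<^sub>3 < i\<^sub>4\<close>.\<close>

definition H_emp :: "nat \<Rightarrow> (nat \<Rightarrow> real) \<Rightarrow> real \<Rightarrow> real" where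
  "H_emp n x t =
     (\<Sum>J | J \<subseteq> {..<n} \<and> card J = 4.
        of_bool (order_statistic 4 J x / order_statistic 3 J x < t)) / real (n choose 4)"

definition F_emp :: "nat \<Rightarrow> (nat \<Rightarrow> real) \<Rightarrow> real \<Rightarrow> real" where
  "F_emp n x t = (\<Sum>i<n. of_bool (x i < t)) / real n"

text \<open>
  The integral of \<open>H_emp n x - F_emp n x\<close> against the empirical distribution, that is, against
  mass \<open>1 / n\<close> at each \<open>x i\<close> (all sample points lie in \<open>[1, \<infinity>)\<close> almost surely).
\<close>

definition I4_stat :: "nat \<Rightarrow> (nat \<Rightarrow> real) \<Rightarrow> real" where
  "I4_stat n x = (\<Sum>i<n. H_emp n x (x i) - F_emp n x (x i)) / real n"

end

theory Submission
  imports Defs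
begin

text \<open>
  If \<open>X\<close> has the Pareto law, then \<open>U = X powr - lam\<close> is uniform on the unit interval, and for four
  observations with \<open>U\<close>-values \<open>a < b < c < d\<close> the ratio of the two largest observations is below a fifth
  observation with value \<open>v\<close> exactly when \<open>v * b < a\<close>. Summing the empirical function \<open>H\<^sub>n\<close> over the sample
  therefore counts tuples of five distinct indices with this property, up to the few terms where the
  fifth index repeats one of the four. The average of \<open>F\<^sub>n\<close> over the sample is the constant \<open>(n - 1) / (2 n)\<close>
  whenever there are no ties, hence almost surely. So the statistic differs by \<open>O (1 / n)\<close> from a U-statistic of
  degree five minus \<open>1 / 2\<close>, which is the mean of its kernel (\<open>I4_stat_approx\<close>, \<open>kernel_mean_spacing\<close>).

  The limit of such a U-statistic comes from Hajek's projection. Subtracting from the kernel its projections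
  on the single coordinates leaves a degenerate kernel. Its values at two tuples with at most one common index
  are orthogonal (\<open>degenerate_orthogonal\<close>), and only a fraction of order \<open>1 / n\<^sup>2\<close> of all pairs of tuples have
  more in common (\<open>card_tuples_overlap\<close>). Hence the remainder has second moment \<open>O (1 / n\<^sup>2)\<close> and is
  invisible at the scale \<open>1 / \<surd>n\<close>, while the projections add up to a mean of
  independent variables to which the classical central limit theorem applies (\<open>U_stat_clt\<close>).

  What remains is calculus. The projections are elementary integrals, their centred sum is
  \<open>- 12 u ln u - 13 u + 18 u\<^sup>2 - 4 u\<^sup>3 - 3 / 2\<close> (\<open>hajek_proj_spacing\<close>), and the integral of its square over
  the unit interval is \<open>271 / 2100\<close> (\<open>integral_hajek_proj_spacing_sq\<close>).
\<close>

section \<open>Weak convergence and the normal law\<close>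

text \<open>
  An error that vanishes in mean does not change a weak limit: \<open>y \<mapsto> exp (\<i> t y)\<close> is Lipschitz with
  constant \<open>\<bar>t\<bar>\<close>, so the characteristic functions of both sequences have the same limit and Levy's
  continuity theorem applies. Integrability is asked for large indices, where a bound on the
  error is typically available.
\<close>

lemma (in prob_space) weak_conv_of_expectation_diff_tendsto_zero:
  fixes A B :: "nat \<Rightarrow> 'a \<Rightarrow> real"
  assumes [measurable]: "\<And>n. A n \<in> borel_measurable M" "\<And>n. B n \<in> borel_measurable M"
    and int: "eventually (\<lambda>n. integrable M (\<lambda>\<omega>. \<bar>A n \<omega> - B n \<omega>\<bar>)) sequentially"
    and diff: "(\<lambda>n. expectation (\<lambda>\<omega>. \<bar>A n \<omega> - B n \<omega>\<bar>)) \<longlonglongrightarrow> 0"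
    and N: "real_distribution N"
    and B: "weak_conv_m (\<lambda>n. distr M borel (B n)) N"
  shows "weak_conv_m (\<lambda>n. distr M borel (A n)) N"
proof (rule levy_continuity)
  fix t :: real
  have rd: "real_distribution (distr M borel f)" if "f \<in> borel_measurable M" for f
    using that by (simp add: real_distribution_distr)
  have charB: "(\<lambda>n. char (distr M borel (B n)) t) \<longlonglongrightarrow> char N t"
    by (rule levy_continuity1[OF _ N B]) (simp add: rd)
  have bound: "cmod (char (distr M borel (A n)) t - char (distr M borel (B n)) t)
      \<le> \<bar>t\<bar> * expectation (\<lambda>\<omega>. \<bar>A n \<omega> - B n \<omega>\<bar>)"
    if int: "integrable M (\<lambda>\<omega>. \<bar>A n \<omega> - B n \<omega>\<bar>)" for n
  proof -
    have i: "integrable M (\<lambda>\<omega>. iexp (t * f \<omega>))" if [measurable]: "f \<in> borel_measurable M" for f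
      by (rule integrable_const_bound[of _ 1]) auto
    have eq: "char (distr M borel f) t = expectation (\<lambda>\<omega>. iexp (t * f \<omega>))"
      if [measurable]: "f \<in> borel_measurable M" for f
      by (simp add: char_def integral_distr)
    have "cmod (expectation (\<lambda>\<omega>. iexp (t * A n \<omega>)) - expectation (\<lambda>\<omega>. iexp (t * B n \<omega>)))
        = cmod (expectation (\<lambda>\<omega>. iexp (t * A n \<omega>) - iexp (t * B n \<omega>)))"
      by (simp only: Bochner_Integration.integral_diff[OF i[OF assms(1)] i[OF assms(2)]])
    also have "\<dots> \<le> expectation (\<lambda>\<omega>. cmod (iexp (t * A n \<omega>) - iexp (t * B n \<omega>)))"
      by (rule integral_norm_bound)
    also have "\<dots> \<le> expectation (\<lambda>\<omega>. \<bar>t\<bar> * \<bar>A n \<omega> - B n \<omega>\<bar>)"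
    proof (rule integral_mono)
      show "integrable M (\<lambda>\<omega>. cmod (iexp (t * A n \<omega>) - iexp (t * B n \<omega>)))"
        by (intro integrable_norm Bochner_Integration.integrable_diff i assms)
      fix \<omega>
      have "iexp (t * A n \<omega>) - iexp (t * B n \<omega>)
          = iexp (t * B n \<omega>) * (iexp (t * (A n \<omega> - B n \<omega>)) - 1)"
        by (simp add: algebra_simps flip: exp_add)
      then have "cmod (iexp (t * A n \<omega>) - iexp (t * B n \<omega>))
          = cmod (iexp (t * (A n \<omega> - B n \<omega>)) - 1)"
        by (simp add: norm_mult)
      also have "\<dots> \<le> \<bar>t * (A n \<omega> - B n \<omega>)\<bar>"
        using iexp_approx1[of "t * (A n \<omega> - B n \<omega>)" 0] by simp
      finally show "cmod (iexp (t * A n \<omega>) - iexp (t * B n \<omega>)) \<le> \<bar>t\<bar> * \<bar>A n \<omega> - B n \<omega>\<bar>"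
        by (simp add: abs_mult)
    qed (use int in auto)
    finally show ?thesis by (simp add: eq)
  qed
  have "(\<lambda>n. char (distr M borel (A n)) t - char (distr M borel (B n)) t) \<longlonglongrightarrow> 0"
    by (rule Lim_null_comparison[OF eventually_mono[OF int bound] tendsto_mult_right_zero[OF diff]])
  from tendsto_add[OF this charB]
  show "(\<lambda>n. char (distr M borel (A n)) t) \<longlonglongrightarrow> char N t" by simp
qed (use N in \<open>simp_all add: real_distribution_distr\<close>)

lemma real_distribution_normal:
  assumes "\<sigma> > 0"
  shows "real_distribution (density lborel (normal_density \<mu> \<sigma>))"
proof -
  interpret prob_space "density lborel (normal_density \<mu> \<sigma>)"
    using assms by (rule prob_space_normal_density)
  show ?thesis by unfold_locales simp_all
qed

lemma density_normal_scale:
  assumes "\<sigma> > 0"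
  shows "distr std_normal_distribution borel (\<lambda>x. \<sigma> * x) = density lborel (normal_density 0 \<sigma>)"
proof -
  interpret P: prob_space std_normal_distribution
    by (rule prob_space_normal_density) simp
  have "distributed std_normal_distribution lborel (\<lambda>x. x) std_normal_density"
    unfolding distributed_def by (auto simp: distr_id2)
  from P.normal_density_affine[OF this, of \<sigma> 0]
  have "distributed std_normal_distribution lborel (\<lambda>x. \<sigma> * x) (normal_density 0 \<sigma>)"
    using assms by simp
  then have "distr std_normal_distribution lborel (\<lambda>x. \<sigma> * x) = density lborel (normal_density 0 \<sigma>)"
    by (rule distributed_distr_eq_density)
  then show ?thesis
    by (metis distr_cong sets_lborel)
qed

lemma char_distr_scale:
  assumes "real_distribution M"
  shows "char (distr M borel (\<lambda>x. c * x)) t = char M (c * t)"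
proof -
  interpret real_distribution M by fact
  show ?thesis by (simp add: char_def integral_distr mult_ac)
qed

text \<open>The central limit theorem normalised by \<open>\<surd>n\<close> only, so that the limit keeps its variance.\<close>

lemma (in prob_space) central_limit_theorem_normal:
  fixes Y :: "nat \<Rightarrow> 'a \<Rightarrow> real"
  assumes indep: "indep_vars (\<lambda>_. borel) Y UNIV"
    and mean: "\<And>n. expectation (Y n) = 0"
    and pos: "\<sigma> > 0"
    and int: "\<And>n. integrable M (\<lambda>x. (Y n x)\<^sup>2)"
    and var: "\<And>n. expectation (\<lambda>x. (Y n x)\<^sup>2) = \<sigma>\<^sup>2"
    and distr: "\<And>n. distr M borel (Y n) = \<mu>"
  shows "weak_conv_m (\<lambda>n. distr M borel (\<lambda>x. (\<Sum>i<n. Y i x) / sqrt (real n)))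
           (density lborel (normal_density 0 \<sigma>))"
proof (rule levy_continuity)
  have [measurable]: "Y n \<in> borel_measurable M" for n
    using indep by (auto simp: indep_vars_def)
  let ?S = "\<lambda>n x. (\<Sum>i<n. Y i x) / sqrt (real n * \<sigma>\<^sup>2)"
  interpret N: real_distribution std_normal_distribution
    using real_distribution_normal[of 1 0] by simp
  have rd: "real_distribution (distr M borel (?S n))" for n
    by (simp add: real_distribution_distr)
  have clt: "weak_conv_m (\<lambda>n. distr M borel (?S n)) std_normal_distribution"
    by (rule central_limit_theorem_zero_mean) (use assms in auto)
  fix t
  have "(\<lambda>n. char (distr M borel (?S n)) (\<sigma> * t)) \<longlonglongrightarrow> char std_normal_distribution (\<sigma> * t)"
    by (rule levy_continuity1[OF _ _ clt]) (simp_all add: rd N.real_distribution_axioms)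
  moreover have "char (distr M borel (?S n)) (\<sigma> * t)
      = char (distr M borel (\<lambda>x. (\<Sum>i<n. Y i x) / sqrt (real n))) t" for n
  proof -
    have "\<sigma> * ?S n x = (\<Sum>i<n. Y i x) / sqrt (real n)" for x
      using pos by (simp add: real_sqrt_mult)
    then show ?thesis
      by (subst char_distr_scale[OF rd, symmetric]) (simp add: distr_distr o_def)
  qed
  moreover have "char std_normal_distribution (\<sigma> * t) = char (density lborel (normal_density 0 \<sigma>)) t"
    by (simp add: char_distr_scale[OF N.real_distribution_axioms, symmetric] density_normal_scale[OF pos])
  ultimately show "(\<lambda>n. char (distr M borel (\<lambda>x. (\<Sum>i<n. Y i x) / sqrt (real n))) t)
      \<longlonglongrightarrow> char (density lborel (normal_density 0 \<sigma>)) t" by simp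
next
  have [measurable]: "Y n \<in> borel_measurable M" for n
    using indep by (auto simp: indep_vars_def)
  show "real_distribution (distr M borel (\<lambda>x. (\<Sum>i<n. Y i x) / sqrt (real n)))" for n
    by (simp add: real_distribution_distr)
qed (rule real_distribution_normal[OF pos])

section \<open>Tuples of distinct indices\<close>

definition tuples :: "nat \<Rightarrow> nat \<Rightarrow> nat list set" where
  "tuples n m = {xs. length xs = m \<and> distinct xs \<and> set xs \<subseteq> {..<n}}"

lemma finite_tuples: "finite (tuples n m)"
  by (rule finite_subset[OF _ finite_lists_length_eq[of "{..<n}" m]]) (auto simp: tuples_def)

lemma nth_tuple_less: "xs \<in> tuples n m \<Longrightarrow> p < m \<Longrightarrow> xs ! p < n"
  unfolding tuples_def using nth_mem[of p xs] by blast

lemma nth_tuple_eq_iff: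
  "xs \<in> tuples n m \<Longrightarrow> p < m \<Longrightarrow> q < m \<Longrightarrow> xs ! p = xs ! q \<longleftrightarrow> p = q"
  by (auto simp: tuples_def nth_eq_iff_index_eq)

lemma map_permutes_tuples:
  assumes "\<sigma> permutes {..<n}"
  shows "map \<sigma> xs \<in> tuples n m \<longleftrightarrow> xs \<in> tuples n m"
proof -
  have "inj \<sigma>" using assms by (rule permutes_inj)
  then have "inj_on \<sigma> (set xs)" by (rule inj_on_subset) simp
  moreover have "\<sigma> ` set xs \<subseteq> {..<n} \<longleftrightarrow> set xs \<subseteq> {..<n}"
    by (metis assms permutes_image \<open>inj \<sigma>\<close> inj_image_subset_iff)
  ultimately show ?thesis by (auto simp: tuples_def distinct_map)
qed

text \<open>
  Transpositions of indices act on tuples, so every index occurs equally often at a given position. The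
  product form avoids a division and covers the case that there are no tuples at all.
\<close>

lemma card_tuples_nth:
  assumes "p < m" "i < n"
  shows "n * card {xs \<in> tuples n m. xs ! p = i} = card (tuples n m)"
proof -
  let ?C = "\<lambda>i. {xs \<in> tuples n m. xs ! p = i}"
  have le: "card (?C k) \<le> card (?C i)" if "k < n" "i < n" for k i
  proof (rule card_inj_on_le[where f = "map (Transposition.transpose k i)"])
    have s: "Transposition.transpose k i permutes {..<n}"
      using that by (intro permutes_swap_id) auto
    then show "map (Transposition.transpose k i) ` ?C k \<subseteq> ?C i"
      using \<open>p < m\<close> by (auto simp: map_permutes_tuples) (auto simp: tuples_def)
    show "finite (?C i)" using finite_tuples by simp
    show "inj_on (map (Transposition.transpose k i)) (?C k)"
      using inj_mapI[OF permutes_inj[OF s]] by (rule inj_on_subset) simp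
  qed
  have "card (tuples n m) = card (\<Union>k<n. ?C k)"
    by (rule arg_cong[where f = card]) (use \<open>p < m\<close> in \<open>auto simp: nth_tuple_less\<close>)
  also have "\<dots> = (\<Sum>k<n. card (?C k))"
    by (rule card_UN_disjoint) (auto simp: finite_tuples)
  also have "\<dots> = (\<Sum>k<n. card (?C i))"
    using le \<open>i < n\<close> by (intro sum.cong refl antisym) auto
  finally show ?thesis by simp
qed

text \<open>
  Permutations act transitively on pairs of distinct indices, so all of them occur
  equally often at two given positions.
\<close>

lemma card_tuples_nth_nth:
  assumes "p < m" "p' < m" "p \<noteq> p'" "i < n" "i' < n" "i \<noteq> i'"
  shows "n * (n - 1) * card {xs \<in> tuples n m. xs ! p = i \<and> xs ! p' = i'} = card (tuples n m)"
proof -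
  let ?C = "\<lambda>(i, i'). {xs \<in> tuples n m. xs ! p = i \<and> xs ! p' = i'}"
  let ?D = "{(k, k'). k < n \<and> k' < n \<and> k \<noteq> k'}"
  have le: "card (?C (k, k')) \<le> card (?C (i, i'))" if "(k, k') \<in> ?D" "(i, i') \<in> ?D" for k k' i i'
  proof (rule card_inj_on_le)
    let ?a = "Transposition.transpose k i"
    define s where "s = Transposition.transpose (?a k') i' \<circ> ?a"
    have s: "s permutes {..<n}" unfolding s_def
      using that by (intro permutes_compose permutes_swap_id) (auto simp: Transposition.transpose_def)
    have sk: "s k = i" "s k' = i'"
      using that by (auto simp: s_def Transposition.transpose_def)
    show "map s ` ?C (k, k') \<subseteq> ?C (i, i')"
      using sk assms(1,2) by (auto simp: map_permutes_tuples[OF s]) (auto simp: tuples_def)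
    show "finite (?C (i, i'))" using finite_tuples by simp
    show "inj_on (map s) (?C (k, k'))"
      using inj_mapI[OF permutes_inj[OF s]] by (rule inj_on_subset) simp
  qed
  have finD: "finite ?D" by (rule finite_subset[of _ "{..<n} \<times> {..<n}"]) auto
  have "card ?D = n * (n - 1)"
  proof -
    have "?D = (SIGMA k:{..<n}. {..<n} - {k})" by auto
    then show ?thesis by simp
  qed
  have "card (tuples n m) = card (\<Union>k\<in>?D. ?C k)"
    by (rule arg_cong[where f = card])
       (use assms in \<open>auto simp: nth_tuple_less nth_tuple_eq_iff\<close>)
  also have "\<dots> = (\<Sum>k\<in>?D. card (?C k))"
    by (rule card_UN_disjoint) (use finD in \<open>auto simp: finite_tuples\<close>)
  also have "\<dots> = (\<Sum>k\<in>?D. card (?C (i, i')))"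
  proof (intro sum.cong refl antisym)
    fix k assume "k \<in> ?D"
    then show "card (?C k) \<le> card (?C (i, i'))" "card (?C (i, i')) \<le> card (?C k)"
      using le[of "fst k" "snd k" i i'] le[of i i' "fst k" "snd k"] assms by auto
  qed
  finally show ?thesis using \<open>card ?D = n * (n - 1)\<close> by simp
qed

text \<open>
  Tuples that overlap twice are so rare that the remainder of the Hajek projection is negligible: the second moment of a mean
  over single indices is of order \<open>1 / n\<close>, while these pairs
  of tuples are only a fraction of order \<open>1 / n\<^sup>2\<close>. The bound sums, over the at most \<open>m\<^sup>4\<close> choices of two matching pairs of positions, the
  exact count of the preceding lemma.
\<close>

lemma card_tuples_overlap:
  assumes "2 \<le> n"
  shows "real (card {(xs, ys) \<in> tuples n m \<times> tuples n m. 2 \<le> card (set xs \<inter> set ys)})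
    \<le> real m ^ 4 * (real (card (tuples n m)))\<^sup>2 / (real n * (real n - 1))"
proof -
  let ?T = "tuples n m" and ?N = "card (tuples n m)"
  let ?O = "{(xs, ys) \<in> ?T \<times> ?T. 2 \<le> card (set xs \<inter> set ys)}"
  let ?Q = "{(p, p', q, q'). p < m \<and> p' < m \<and> q < m \<and> q' < m \<and> p \<noteq> p' \<and> q \<noteq> q'}"
  let ?R = "\<lambda>((p, p', q, q'), ys). {xs \<in> ?T. xs ! p = ys ! q \<and> xs ! p' = ys ! q'}"
  have finQ: "finite ?Q"
    by (rule finite_subset[of _ "{..<m} \<times> {..<m} \<times> {..<m} \<times> {..<m}"]) auto
  have "card ?Q \<le> card ({..<m} \<times> {..<m} \<times> {..<m} \<times> {..<m})"
    by (rule card_mono) auto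
  then have cardQ: "card ?Q \<le> m ^ 4"
    by (simp add: card_cartesian_product power4_eq_xxxx mult_ac)
  have "?O \<subseteq> (\<Union>(a, ys)\<in>?Q \<times> ?T. (\<lambda>xs. (xs, ys)) ` ?R (a, ys))"
  proof
    fix z assume "z \<in> ?O"
    then obtain xs ys where z: "z = (xs, ys)" and xs: "xs \<in> ?T" and ys: "ys \<in> ?T"
      and c: "2 \<le> card (set xs \<inter> set ys)" by auto
    obtain i i' where "i \<in> set xs \<inter> set ys" "i' \<in> set xs \<inter> set ys" "i \<noteq> i'"
    proof -
      have "set xs \<inter> set ys \<noteq> {}" using c by (metis card.empty not_numeral_le_zero)
      then obtain i where i: "i \<in> set xs \<inter> set ys" by blast
      have "card (set xs \<inter> set ys - {i}) \<noteq> 0" using c i by (simp add: card_Diff_singleton)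
      then have "set xs \<inter> set ys - {i} \<noteq> {}" by (metis card.empty)
      then obtain i' where "i' \<in> set xs \<inter> set ys - {i}" by blast
      then show ?thesis using that i by auto
    qed
    then obtain p p' q q' where "p < m" "xs ! p = i" "p' < m" "xs ! p' = i'"
      "q < m" "ys ! q = i" "q' < m" "ys ! q' = i'"
      using xs ys by (auto simp: tuples_def in_set_conv_nth)
    moreover from this have "p \<noteq> p'" "q \<noteq> q'" using \<open>i \<noteq> i'\<close> by auto
    ultimately show "z \<in> (\<Union>(a, ys)\<in>?Q \<times> ?T. (\<lambda>xs. (xs, ys)) ` ?R (a, ys))"
      using xs ys unfolding z by (intro UN_I[of "((p, p', q, q'), ys)"]) auto
  qed
  then have "card ?O \<le> card (\<Union>(a, ys)\<in>?Q \<times> ?T. (\<lambda>xs. (xs, ys)) ` ?R (a, ys))"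
    by (rule card_mono[rotated]) (use finQ finite_tuples in auto)
  also have "\<dots> \<le> (\<Sum>(a, ys)\<in>?Q \<times> ?T. card ((\<lambda>xs. (xs, ys)) ` ?R (a, ys)))"
    using card_UN_le[of "?Q \<times> ?T" "\<lambda>(a, ys). (\<lambda>xs. (xs, ys)) ` ?R (a, ys)"] finQ finite_tuples
    by (simp add: case_prod_unfold)
  also have "\<dots> \<le> (\<Sum>(a, ys)\<in>?Q \<times> ?T. card (?R (a, ys)))"
    by (intro sum_mono) (auto intro!: card_image_le simp: finite_tuples)
  finally have O: "card ?O \<le> (\<Sum>(a, ys)\<in>?Q \<times> ?T. card (?R (a, ys)))" .
  have R: "real (card (?R (a, ys))) = real ?N / (real n * (real n - 1))" if "(a, ys) \<in> ?Q \<times> ?T" for a ys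
  proof -
    obtain p p' q q' where a: "a = (p, p', q, q')" by (cases a)
    have "ys ! q < n" "ys ! q' < n" "ys ! q \<noteq> ys ! q'"
      using that by (auto simp: a nth_tuple_less nth_tuple_eq_iff)
    then have "n * (n - 1) * card (?R (a, ys)) = ?N"
      using card_tuples_nth_nth[of p m p' "ys ! q" n "ys ! q'"] that by (simp add: a)
    from arg_cong[OF this, of real] show ?thesis
      using assms by (simp add: field_simps of_nat_diff)
  qed
  have "real (card ?O) \<le> (\<Sum>(a, ys)\<in>?Q \<times> ?T. real (card (?R (a, ys))))"
    using O by (subst (asm) of_nat_le_iff[where 'a = real, symmetric]) (simp add: case_prod_unfold)
  also have "\<dots> = (\<Sum>(a, ys)\<in>?Q \<times> ?T. real ?N / (real n * (real n - 1)))"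
    by (rule sum.cong) (use R in auto)
  also have "\<dots> = real (card ?Q) * real ?N * (real ?N / (real n * (real n - 1)))"
    by (simp add: card_cartesian_product)
  also have "\<dots> \<le> real m ^ 4 * real ?N * (real ?N / (real n * (real n - 1)))"
    using cardQ assms by (intro mult_right_mono) (auto simp flip: of_nat_power)
  finally show ?thesis by (simp add: power2_eq_square)
qed

section \<open>U-statistics of independent identically distributed samples\<close>

text \<open>
  The restriction makes a sample an extensional function, that is, a point of the product space
  indexed by \<open>{..<length xs}\<close>.
\<close>

definition sample :: "(nat \<Rightarrow> 'b) \<Rightarrow> nat list \<Rightarrow> nat \<Rightarrow> 'b" where
  "sample x xs = (\<lambda>j\<in>{..<length xs}. x (xs ! j))"

lemma abs_expectation_le:
  fixes f :: "'c \<Rightarrow> real"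
  assumes "prob_space N" "\<And>y. \<bar>f y\<bar> \<le> b"
  shows "\<bar>integral\<^sup>L N f\<bar> \<le> b"
proof -
  interpret N: prob_space N by fact
  have b0: "0 \<le> b" using assms(2)[of undefined] by simp
  show ?thesis
  proof (cases "integrable N f")
    case True
    then have "\<bar>integral\<^sup>L N f\<bar> \<le> (\<integral>y. \<bar>f y\<bar> \<partial>N)" using integral_norm_bound[of N f] by simp
    also have "\<dots> \<le> (\<integral>y. b \<partial>N)" using True assms(2) by (intro integral_mono) auto
    finally show ?thesis by (simp add: N.prob_space)
  qed (simp add: not_integrable_integral_eq b0)
qed

text \<open>
  The measure \<open>\<mu>\<close> serves both as the common law and, through its measurable sets, as the value space.
\<close>

locale iid_sample = prob_space M for M :: "'a measure" +
  fixes X :: "nat \<Rightarrow> 'a \<Rightarrow> 'b" and \<mu> :: "'b measure"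
  assumes indep: "indep_vars (\<lambda>_. \<mu>) X UNIV"
    and law: "\<And>i. distr M \<mu> (X i) = \<mu>"
begin

lemma X_measurable [measurable]: "X i \<in> measurable M \<mu>"
  using indep by (auto simp: indep_vars_def)

sublocale law: prob_space \<mu>
  using prob_space_distr[OF X_measurable[of 0]] by (simp add: law)

abbreviation law_power :: "nat \<Rightarrow> (nat \<Rightarrow> 'b) measure" where
  "law_power m \<equiv> PiM {..<m} (\<lambda>_. \<mu>)"

sublocale product_sigma_finite "\<lambda>_::nat. \<mu>"
  by unfold_locales

lemma prob_space_law_power: "prob_space (PiM I (\<lambda>_. \<mu>))"
  by (rule prob_space_PiM) (rule law.prob_space_axioms)

abbreviation X_sample :: "nat list \<Rightarrow> 'a \<Rightarrow> nat \<Rightarrow> 'b" where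
  "X_sample xs \<omega> \<equiv> sample (\<lambda>i. X i \<omega>) xs"

lemma measurable_X_sample [measurable]:
  "length xs = m \<Longrightarrow> X_sample xs \<in> measurable M (law_power m)"
  unfolding sample_def by (auto intro!: measurable_restrict)

lemma distr_X_sample:
  assumes "distinct xs" "length xs = m"
  shows "distr M (law_power m) (X_sample xs) = law_power m"
proof -
  have "distr M (PiM UNIV (\<lambda>_. \<mu>)) (\<lambda>\<omega>. \<lambda>i\<in>UNIV. X i \<omega>) = PiM UNIV (\<lambda>i. distr M \<mu> (X i))"
    by (rule indep_vars_iff_distr_eq_PiM[THEN iffD1, OF _ _ indep]) auto
  then have D: "distr M (PiM UNIV (\<lambda>_. \<mu>)) (\<lambda>\<omega> i. X i \<omega>) = PiM UNIV (\<lambda>_. \<mu>)"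
    by (simp add: law restrict_UNIV)
  have "law_power m = distr (PiM UNIV (\<lambda>_. \<mu>)) (law_power m) (\<lambda>\<omega>. \<lambda>j\<in>{..<m}. \<omega> (xs ! j))"
    using assms by (intro distr_PiM_reindex[symmetric] law.prob_space_axioms)
      (auto simp: inj_on_def nth_eq_iff_index_eq)
  also have "\<dots> = distr (distr M (PiM UNIV (\<lambda>_. \<mu>)) (\<lambda>\<omega> i. X i \<omega>)) (law_power m)
      (\<lambda>\<omega>. \<lambda>j\<in>{..<m}. \<omega> (xs ! j))"
    by (simp only: D)
  also have "\<dots> = distr M (law_power m) (X_sample xs)"
    using assms(2) by (subst distr_distr) (auto simp: o_def sample_def intro!: measurable_restrict measurable_PiM_single' measurable_space[OF X_measurable])
  finally show ?thesis by simp
qed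

lemma measurable_fun_upd_law_power:
  assumes "j < m" "x \<in> space \<mu>"
  shows "(\<lambda>y. y(j := x)) \<in> measurable (law_power m) (law_power m)"
  using assms by (intro measurable_fun_upd[where J = "{..<m}"]) auto

text \<open>
  Overwriting one coordinate by an independent copy does not change the law of a sample. Integrating
  out the overwritten coordinate first leaves a double integral over the new value and the other
  coordinates, where Fubini's theorem restores the product.
\<close>

lemma integral_fun_upd_law_power:
  fixes f :: "(nat \<Rightarrow> 'b) \<Rightarrow> real"
  assumes [measurable]: "f \<in> borel_measurable (law_power m)" and b: "\<And>y. \<bar>f y\<bar> \<le> b" and j: "j < m"
  shows "(\<integral>x. (\<integral>y. f (y(j := x)) \<partial>law_power m) \<partial>\<mu>) = (\<integral>y. f y \<partial>law_power m)"
proof -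
  let ?I = "{..<m} - {j}"
  have I: "{..<m} = insert j ?I" using j by auto
  interpret Q: prob_space "PiM ?I (\<lambda>_. \<mu>)" by (rule prob_space_law_power)
  interpret P: prob_space "law_power m" by (rule prob_space_law_power)
  interpret pair: pair_sigma_finite \<mu> "PiM ?I (\<lambda>_. \<mu>)" ..
  interpret pairp: pair_prob_space \<mu> "PiM ?I (\<lambda>_. \<mu>)" ..
  have ins: "(\<integral>y. g y \<partial>law_power m) = (\<integral>y. (\<integral>x. g (y(j := x)) \<partial>\<mu>) \<partial>PiM ?I (\<lambda>_. \<mu>))"
    if [measurable]: "g \<in> borel_measurable (law_power m)" and gb: "\<And>y. \<bar>g y\<bar> \<le> b" for g :: "_ \<Rightarrow> real"
  proof -
    have "integrable (PiM (insert j ?I) (\<lambda>_. \<mu>)) g"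
      unfolding I[symmetric] by (rule P.integrable_const_bound[of _ b]) (auto simp: gb)
    from product_integral_insert[OF _ _ this] show ?thesis unfolding I[symmetric] by simp
  qed
  have [measurable]: "(\<lambda>(x, y). y(j := x)) \<in> measurable (\<mu> \<Otimes>\<^sub>M PiM ?I (\<lambda>_. \<mu>)) (law_power m)"
    unfolding case_prod_unfold by (intro measurable_fun_upd[where J = ?I]) (use j in auto)
  have "(\<integral>x. (\<integral>y. f (y(j := x)) \<partial>law_power m) \<partial>\<mu>)
      = (\<integral>x. (\<integral>y. f (y(j := x)) \<partial>PiM ?I (\<lambda>_. \<mu>)) \<partial>\<mu>)"
  proof (rule Bochner_Integration.integral_cong[OF refl])
    fix x assume x: "x \<in> space \<mu>"
    note [measurable] = measurable_fun_upd_law_power[OF j x]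
    show "(\<integral>y. f (y(j := x)) \<partial>law_power m) = (\<integral>y. f (y(j := x)) \<partial>PiM ?I (\<lambda>_. \<mu>))"
      by (subst ins) (auto simp: b law.prob_space)
  qed
  also have "\<dots> = (\<integral>y. (\<integral>x. f (y(j := x)) \<partial>\<mu>) \<partial>PiM ?I (\<lambda>_. \<mu>))"
    by (rule pair.Fubini_integral[symmetric])
       (rule pairp.P.integrable_const_bound[of _ b], auto simp: b)
  also have "\<dots> = (\<integral>y. f y \<partial>law_power m)"
    by (rule ins[symmetric]) (auto simp: b)
  finally show ?thesis .
qed

text \<open>
  The vanishing of the constant and linear terms in Hoeffding's decomposition; for \<open>m > 0\<close> the constant
  one, the mean, vanishes because the condition may be integrated over \<open>x\<close>.
\<close>

definition degenerate :: "nat \<Rightarrow> ((nat \<Rightarrow> 'b) \<Rightarrow> real) \<Rightarrow> bool" where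
  "degenerate m z \<longleftrightarrow> (\<forall>j<m. \<forall>x\<in>space \<mu>. (\<integral>y. z (y(j := x)) \<partial>law_power m) = 0)"

text \<open>
  By independence the joint law is a product, so Fubini's theorem allows integrating over \<open>W\<close> first.
\<close>

lemma expectation_eq_0_of_frozen:
  fixes f :: "'c \<times> 'c \<Rightarrow> real"
  assumes ind: "indep_var S Y T W" and [measurable]: "f \<in> borel_measurable (S \<Otimes>\<^sub>M T)"
    and b: "\<And>p. \<bar>f p\<bar> \<le> b"
    and frozen: "\<And>a. a \<in> space S \<Longrightarrow> expectation (\<lambda>\<omega>. f (a, W \<omega>)) = 0"
  shows "expectation (\<lambda>\<omega>. f (Y \<omega>, W \<omega>)) = 0"
proof -
  have [measurable]: "Y \<in> measurable M S" "W \<in> measurable M T"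
    and D: "distr M S Y \<Otimes>\<^sub>M distr M T W = distr M (S \<Otimes>\<^sub>M T) (\<lambda>x. (Y x, W x))"
    using ind by (auto simp: indep_var_distribution_eq)
  interpret S: prob_space "distr M S Y" by (rule prob_space_distr) simp
  interpret T: prob_space "distr M T W" by (rule prob_space_distr) simp
  interpret pairp: pair_prob_space "distr M S Y" "distr M T W" ..
  have "expectation (\<lambda>\<omega>. f (Y \<omega>, W \<omega>)) = (\<integral>p. f p \<partial>(distr M S Y \<Otimes>\<^sub>M distr M T W))"
    unfolding D by (subst integral_distr) auto
  also have "\<dots> = (\<integral>a. (\<integral>c. f (a, c) \<partial>distr M T W) \<partial>distr M S Y)"
    by (rule pairp.integral_fst'[symmetric], rule pairp.P.integrable_const_bound[of _ b]) (auto simp: b)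
  also have "\<dots> = (\<integral>a. 0 \<partial>distr M S Y)"
    by (intro Bochner_Integration.integral_cong refl)
       (auto simp: integral_distr frozen)
  finally show ?thesis by simp
qed

text \<open>
  If two tuples share at most the index at position \<open>q\<close> of the second one, freeze all variables
  of the first tuple together with that index. What remains random is a fresh sample with coordinate \<open>q\<close>
  overwritten, and degeneracy makes its mean zero.
\<close>

lemma degenerate_orthogonal:
  assumes [measurable]: "z \<in> borel_measurable (law_power m)" "w \<in> borel_measurable (law_power m)"
    and zb: "\<And>y. \<bar>z y\<bar> \<le> b" and wb: "\<And>y. \<bar>w y\<bar> \<le> b" and w: "degenerate m w"
    and xs: "distinct xs" "length xs = m" and ys: "distinct ys" "length ys = m"
    and share: "card (set xs \<inter> set ys) \<le> 1" and "0 < m"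
  shows "expectation (\<lambda>\<omega>. z (X_sample xs \<omega>) * w (X_sample ys \<omega>)) = 0"
proof -
  obtain q where q: "q < m" "set xs \<inter> set ys \<subseteq> {ys ! q}"
  proof (cases "set xs \<inter> set ys = {}")
    case True
    then show ?thesis using that[of 0] \<open>0 < m\<close> by auto
  next
    case False
    then obtain i where i: "i \<in> set xs \<inter> set ys" by blast
    then obtain q where "q < m" "ys ! q = i" using ys by (auto simp: in_set_conv_nth)
    moreover have "set xs \<inter> set ys \<subseteq> {i}"
      using share i by (metis card_le_Suc0_iff_eq finite_Int finite_set One_nat_def singletonI subsetI singletonD)
    ultimately show ?thesis using that by auto
  qed
  define A where "A = insert (ys ! q) (set xs)"
  define B where "B = set ys - {ys ! q}"
  have AB: "A \<inter> B = {}" using q by (auto simp: A_def B_def)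
  have inA: "xs ! j \<in> A" if "j < m" for j using that xs by (auto simp: A_def)
  have qA: "ys ! q \<in> A" by (simp add: A_def)
  have inB: "ys ! j \<in> B" if "j < m" "j \<noteq> q" for j
    using that q(1) ys by (auto simp: B_def nth_eq_iff_index_eq)
  define g where "g = (\<lambda>(a, c). \<lambda>j\<in>{..<m}. if j = q then a (ys ! q) else c (ys ! j) :: 'b)"
  define f where "f = (\<lambda>p. z (sample (fst p) xs) * w (g p))"
  let ?A = "PiM A (\<lambda>_. \<mu>)" and ?B = "PiM B (\<lambda>_. \<mu>)"
  let ?XA = "\<lambda>\<omega>. restrict (\<lambda>i. X i \<omega>) A" and ?XB = "\<lambda>\<omega>. restrict (\<lambda>i. X i \<omega>) B"
  have ind: "indep_var ?A ?XA ?B ?XB"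
    by (rule indep_var_restrict[OF indep AB]) auto
  have [measurable]: "(\<lambda>a. sample a xs) \<in> measurable ?A (law_power m)"
    unfolding sample_def xs(2) using inA by (auto intro!: measurable_restrict)
  have [measurable]: "g \<in> measurable (?A \<Otimes>\<^sub>M ?B) (law_power m)"
    unfolding case_prod_unfold g_def
  proof (rule measurable_restrict)
    fix j assume "j \<in> {..<m}"
    then show "(\<lambda>p. if j = q then fst p (ys ! q) else snd p (ys ! j)) \<in> measurable (?A \<Otimes>\<^sub>M ?B) \<mu>"
      using inB[of j] qA
      by (cases "j = q") (auto intro!: measurable_compose[OF measurable_fst] measurable_compose[OF measurable_snd])
  qed
  have f_meas: "f \<in> borel_measurable (?A \<Otimes>\<^sub>M ?B)" unfolding f_def by measurable
  have fb: "\<bar>f p\<bar> \<le> b * b" for p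
    unfolding f_def abs_mult by (intro mult_mono zb wb) (use zb[of undefined] in auto)
  have frozen: "expectation (\<lambda>\<omega>. f (a, ?XB \<omega>)) = 0" if a: "a \<in> space ?A" for a
  proof -
    have aq: "a (ys ! q) \<in> space \<mu>" using a qA by (auto simp: space_PiM)
    have "g (a, ?XB \<omega>) = (X_sample ys \<omega>)(q := a (ys ! q))" for \<omega>
      using inB q(1) ys by (auto simp: g_def sample_def fun_eq_iff)
    then have "expectation (\<lambda>\<omega>. f (a, ?XB \<omega>))
        = expectation (\<lambda>\<omega>. z (sample a xs) * w ((X_sample ys \<omega>)(q := a (ys ! q))))"
      by (simp add: f_def)
    also have "\<dots> = z (sample a xs) * expectation (\<lambda>\<omega>. w ((X_sample ys \<omega>)(q := a (ys ! q))))"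
      by simp
    also have "expectation (\<lambda>\<omega>. w ((X_sample ys \<omega>)(q := a (ys ! q))))
        = (\<integral>y. w (y(q := a (ys ! q))) \<partial>distr M (law_power m) (X_sample ys))"
      using measurable_fun_upd_law_power[OF q(1) aq] ys(2)
      by (intro integral_distr[symmetric]) auto
    also have "\<dots> = 0"
      using w q(1) aq unfolding distr_X_sample[OF ys] degenerate_def by auto
    finally show ?thesis by (simp only: mult_zero_right)
  qed
  have "expectation (\<lambda>\<omega>. f (?XA \<omega>, ?XB \<omega>)) = 0"
    by (rule expectation_eq_0_of_frozen[OF ind f_meas fb frozen])
  moreover have "sample (?XA \<omega>) xs = X_sample xs \<omega>" for \<omega>
    using inA xs by (auto simp: sample_def fun_eq_iff)
  moreover have "g (?XA \<omega>, ?XB \<omega>) = X_sample ys \<omega>" for \<omega>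
    using inB qA ys by (auto simp: g_def sample_def fun_eq_iff)
  ultimately show ?thesis by (simp add: f_def)
qed

text \<open>
  Expanding the square, only the rare pairs of tuples with two common indices survive orthogonality.
\<close>

lemma degenerate_sum_second_moment:
  assumes [measurable]: "z \<in> borel_measurable (law_power m)"
    and zb: "\<And>y. \<bar>z y\<bar> \<le> b" and z: "degenerate m z" and "0 < m" and n: "2 \<le> n"
  shows "expectation (\<lambda>\<omega>. (\<Sum>xs\<in>tuples n m. z (X_sample xs \<omega>))\<^sup>2)
    \<le> b\<^sup>2 * (real m ^ 4 * (real (card (tuples n m)))\<^sup>2 / (real n * (real n - 1)))"
proof -
  let ?T = "tuples n m"
  let ?O = "{(xs, ys) \<in> ?T \<times> ?T. 2 \<le> card (set xs \<inter> set ys)}"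
  let ?e = "\<lambda>(xs, ys). expectation (\<lambda>\<omega>. z (X_sample xs \<omega>) * z (X_sample ys \<omega>))"
  have b0: "0 \<le> b" using zb[of undefined] by simp
  have prodb: "\<bar>z y * z y'\<bar> \<le> b * b" for y y'
    unfolding abs_mult by (intro mult_mono zb) (use b0 in auto)
  have int: "integrable M (\<lambda>\<omega>. z (X_sample xs \<omega>) * z (X_sample ys \<omega>))" if "xs \<in> ?T" "ys \<in> ?T" for xs ys
  proof -
    have [simp]: "length xs = m" "length ys = m" using that by (auto simp: tuples_def)
    show ?thesis by (rule integrable_const_bound[of _ "b * b"]) (auto simp: prodb)
  qed
  have finO: "finite ?O"
    by (rule finite_subset[of _ "?T \<times> ?T"]) (auto simp: finite_tuples)
  have "expectation (\<lambda>\<omega>. (\<Sum>xs\<in>?T. z (X_sample xs \<omega>))\<^sup>2)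
      = expectation (\<lambda>\<omega>. \<Sum>(xs, ys)\<in>?T \<times> ?T. z (X_sample xs \<omega>) * z (X_sample ys \<omega>))"
    by (simp add: power2_eq_square sum_product sum.cartesian_product)
  also have "\<dots> = (\<Sum>p\<in>?T \<times> ?T. ?e p)"
    unfolding case_prod_unfold by (rule Bochner_Integration.integral_sum) (auto intro!: int)
  also have "\<dots> = (\<Sum>p\<in>?O. ?e p)"
  proof (rule sum.mono_neutral_right)
    show "\<forall>p\<in>?T \<times> ?T - ?O. ?e p = 0"
    proof
      fix p assume p: "p \<in> ?T \<times> ?T - ?O"
      obtain xs ys where "p = (xs, ys)" by (cases p)
      with p show "?e p = 0"
        using degenerate_orthogonal[of z m z b xs ys, OF assms(1) assms(1) zb zb z] \<open>0 < m\<close>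
        by (auto simp: tuples_def)
    qed
  qed (auto simp: finite_tuples)
  also have "\<dots> \<le> (\<Sum>p\<in>?O. b\<^sup>2)"
  proof (rule sum_mono)
    fix p assume "p \<in> ?O"
    then have p: "fst p \<in> ?T" "snd p \<in> ?T" by auto
    have "?e p \<le> expectation (\<lambda>\<omega>. b\<^sup>2)"
      unfolding case_prod_unfold using prodb
      by (intro integral_mono int p) (auto simp: power2_eq_square abs_le_iff)
    then show "?e p \<le> b\<^sup>2" by (simp add: prob_space)
  qed
  also have "\<dots> = b\<^sup>2 * real (card ?O)" by simp
  also have "\<dots> \<le> b\<^sup>2 * (real m ^ 4 * (real (card ?T))\<^sup>2 / (real n * (real n - 1)))"
    by (intro mult_left_mono card_tuples_overlap n) auto
  finally show ?thesis .
qed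

text \<open>
  Kernels may be asymmetric, so there is one projection for each position, and their centred
  sum is the function that carries the fluctuations of the U-statistic.
\<close>

definition kernel_mean :: "nat \<Rightarrow> ((nat \<Rightarrow> 'b) \<Rightarrow> real) \<Rightarrow> real" where
  "kernel_mean m k = (\<integral>y. k y \<partial>law_power m)"

definition kernel_proj :: "nat \<Rightarrow> ((nat \<Rightarrow> 'b) \<Rightarrow> real) \<Rightarrow> nat \<Rightarrow> 'b \<Rightarrow> real" where
  "kernel_proj m k j x = (\<integral>y. k (y(j := x)) \<partial>law_power m)"

definition hajek_proj :: "nat \<Rightarrow> ((nat \<Rightarrow> 'b) \<Rightarrow> real) \<Rightarrow> 'b \<Rightarrow> real" where
  "hajek_proj m k x = (\<Sum>j<m. kernel_proj m k j x - kernel_mean m k)"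

definition U_stat :: "nat \<Rightarrow> ((nat \<Rightarrow> 'b) \<Rightarrow> real) \<Rightarrow> nat \<Rightarrow> 'a \<Rightarrow> real" where
  "U_stat m k n \<omega> = (\<Sum>xs\<in>tuples n m. k (X_sample xs \<omega>)) / real (card (tuples n m))"

lemma U_stat_measurable [measurable]:
  assumes [measurable]: "k \<in> borel_measurable (law_power m)"
  shows "U_stat m k n \<in> borel_measurable M"
proof -
  have [measurable]: "(\<lambda>\<omega>. k (X_sample xs \<omega>)) \<in> borel_measurable M" if "xs \<in> tuples n m" for xs
  proof -
    have [simp]: "length xs = m" using that by (simp add: tuples_def)
    show ?thesis by measurable
  qed
  show ?thesis unfolding U_stat_def[abs_def] by measurable
qed

lemma kernel_proj_measurable:
  assumes [measurable]: "k \<in> borel_measurable (law_power m)" and "j < m"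
  shows "kernel_proj m k j \<in> borel_measurable \<mu>"
proof -
  interpret P: prob_space "law_power m" by (rule prob_space_law_power)
  have [measurable]: "(\<lambda>(x, y). y(j := x)) \<in> measurable (\<mu> \<Otimes>\<^sub>M law_power m) (law_power m)"
    unfolding case_prod_unfold by (intro measurable_fun_upd[where J = "{..<m}"]) (use \<open>j < m\<close> in auto)
  show ?thesis unfolding kernel_proj_def[abs_def] by measurable
qed

lemma hajek_proj_measurable [measurable]:
  assumes "k \<in> borel_measurable (law_power m)"
  shows "hajek_proj m k \<in> borel_measurable \<mu>"
  unfolding hajek_proj_def[abs_def] using assms
  by (intro borel_measurable_sum borel_measurable_diff borel_measurable_const kernel_proj_measurable) auto

context
  fixes m :: nat and k :: "(nat \<Rightarrow> 'b) \<Rightarrow> real" and b :: real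
  assumes k [measurable]: "k \<in> borel_measurable (law_power m)" and kb: "\<And>y. \<bar>k y\<bar> \<le> b"
begin

lemma abs_kernel_mean_le: "\<bar>kernel_mean m k\<bar> \<le> b"
  unfolding kernel_mean_def by (rule abs_expectation_le[OF prob_space_law_power kb])

lemma abs_kernel_proj_le: "\<bar>kernel_proj m k j x\<bar> \<le> b"
  unfolding kernel_proj_def by (rule abs_expectation_le[OF prob_space_law_power kb])

lemma abs_hajek_proj_le: "\<bar>hajek_proj m k x\<bar> \<le> 2 * real m * b"
proof -
  have "\<bar>hajek_proj m k x\<bar> \<le> (\<Sum>j<m. 2 * b)"
    unfolding hajek_proj_def
    by (rule order_trans[OF sum_abs], rule sum_mono)
       (use abs_kernel_mean_le abs_kernel_proj_le[of _ x] in \<open>smt (verit, best)\<close>)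
  then show ?thesis by (simp add: mult_ac)
qed

lemma integral_kernel_proj: "j < m \<Longrightarrow> (\<integral>x. kernel_proj m k j x \<partial>\<mu>) = kernel_mean m k"
  unfolding kernel_proj_def kernel_mean_def by (rule integral_fun_upd_law_power[OF k kb])

lemma integral_hajek_proj: "(\<integral>x. hajek_proj m k x \<partial>\<mu>) = 0"
proof -
  have int: "integrable \<mu> (kernel_proj m k j)" if "j < m" for j
    using kernel_proj_measurable[OF k that] abs_kernel_proj_le[of j]
    by (intro law.integrable_const_bound[of _ b]) auto
  have "(\<integral>x. hajek_proj m k x \<partial>\<mu>) = (\<Sum>j<m. \<integral>x. kernel_proj m k j x - kernel_mean m k \<partial>\<mu>)"
    unfolding hajek_proj_def by (intro Bochner_Integration.integral_sum) (auto intro!: int)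
  also have "\<dots> = (\<Sum>j<m. 0)"
    by (intro sum.cong refl) (simp add: int integral_kernel_proj law.prob_space)
  finally show ?thesis by simp
qed

definition kernel_remainder :: "(nat \<Rightarrow> 'b) \<Rightarrow> real" where
  "kernel_remainder y =
     k y - kernel_mean m k - (\<Sum>j<m. kernel_proj m k j (y j) - kernel_mean m k)"

lemma kernel_remainder_measurable [measurable]: "kernel_remainder \<in> borel_measurable (law_power m)"
proof -
  have "(\<lambda>y. kernel_proj m k j (y j)) \<in> borel_measurable (law_power m)" if "j < m" for j
    using measurable_compose[OF measurable_component_singleton[of j "{..<m}" "\<lambda>_. \<mu>"]
        kernel_proj_measurable[OF k that]] that by simp
  then show ?thesis unfolding kernel_remainder_def[abs_def]
    by (intro borel_measurable_diff borel_measurable_sum borel_measurable_const k) auto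
qed

lemma abs_kernel_remainder_le: "\<bar>kernel_remainder y\<bar> \<le> 2 * (real m + 1) * b"
proof -
  have "\<bar>\<Sum>j<m. kernel_proj m k j (y j) - kernel_mean m k\<bar> \<le> (\<Sum>j<m. 2 * b)"
    by (rule order_trans[OF sum_abs], rule sum_mono)
       (use abs_kernel_mean_le abs_kernel_proj_le[of _ "y _"] in \<open>smt (verit, best)\<close>)
  then show ?thesis
    using kb[of y] abs_kernel_mean_le by (simp add: kernel_remainder_def algebra_simps abs_le_iff)
qed

text \<open>
  Fixing coordinate \<open>l\<close> turns the mean of the kernel into its projection at \<open>l\<close>; this is cancelled by the
  \<open>l\<close>-th summand of the correction, while the other summands keep mean zero.
\<close>

lemma degenerate_kernel_remainder: "degenerate m kernel_remainder"
  unfolding degenerate_def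
proof (intro allI impI ballI)
  fix l x assume l: "l < m" and x: "x \<in> space \<mu>"
  interpret P: prob_space "law_power m" by (rule prob_space_law_power)
  note [measurable] = measurable_fun_upd_law_power[OF l x]
  have pm: "(\<lambda>y. kernel_proj m k j (y j)) \<in> borel_measurable (law_power m)" if "j < m" for j
    using measurable_compose[OF measurable_component_singleton[of j "{..<m}" "\<lambda>_. \<mu>"]
        kernel_proj_measurable[OF k that]] that by simp
  have int_proj: "integrable (law_power m) (\<lambda>y. kernel_proj m k j ((y(l := x)) j))" if "j < m" for j
    by (rule P.integrable_const_bound[of _ b])
       (use abs_kernel_proj_le measurable_compose[OF measurable_fun_upd_law_power[OF l x] pm[OF that]] in auto)
  have "(\<integral>y. kernel_proj m k j (y j) \<partial>law_power m) = kernel_mean m k" if "j < m" for j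
  proof -
    have "(\<integral>y. kernel_proj m k j (y j) \<partial>law_power m)
        = (\<integral>x. kernel_proj m k j x \<partial>distr (law_power m) \<mu> (\<lambda>y. y j))"
      using that by (intro integral_distr[symmetric] kernel_proj_measurable[OF k]) auto
    also have "distr (law_power m) \<mu> (\<lambda>y. y j) = \<mu>"
      using distr_PiM_component[of "{..<m}" "\<lambda>_. \<mu>" j] law.prob_space_axioms that by simp
    finally show ?thesis using integral_kernel_proj[OF that] by simp
  qed
  then have proj: "(\<integral>y. kernel_proj m k j ((y(l := x)) j) \<partial>law_power m)
      = (if j = l then kernel_proj m k l x else kernel_mean m k)" if "j < m" for j
    using that by (simp add: P.prob_space)
  have "(\<integral>y. kernel_remainder (y(l := x)) \<partial>law_power m)
      = (\<integral>y. k (y(l := x)) \<partial>law_power m) - kernel_mean m k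
        - (\<Sum>j<m. (\<integral>y. kernel_proj m k j ((y(l := x)) j) \<partial>law_power m) - kernel_mean m k)"
  proof -
    have ik: "integrable (law_power m) (\<lambda>y. k (y(l := x)))"
      by (rule P.integrable_const_bound[of _ b]) (auto simp: kb)
    have isum: "integrable (law_power m) (\<lambda>y. \<Sum>j<m. kernel_proj m k j ((y(l := x)) j) - kernel_mean m k)"
      by (intro Bochner_Integration.integrable_sum Bochner_Integration.integrable_diff int_proj
          P.integrable_const) (simp only: lessThan_iff)
    have "(\<integral>y. kernel_remainder (y(l := x)) \<partial>law_power m)
        = (\<integral>y. k (y(l := x)) - kernel_mean m k \<partial>law_power m)
        - (\<integral>y. (\<Sum>j<m. kernel_proj m k j ((y(l := x)) j) - kernel_mean m k) \<partial>law_power m)"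
      unfolding kernel_remainder_def
      by (intro Bochner_Integration.integral_diff Bochner_Integration.integrable_diff ik isum P.integrable_const)
    also have "(\<integral>y. k (y(l := x)) - kernel_mean m k \<partial>law_power m)
        = (\<integral>y. k (y(l := x)) \<partial>law_power m) - kernel_mean m k"
      using ik by (simp add: P.prob_space)
    also have "(\<integral>y. (\<Sum>j<m. kernel_proj m k j ((y(l := x)) j) - kernel_mean m k) \<partial>law_power m)
        = (\<Sum>j<m. \<integral>y. kernel_proj m k j ((y(l := x)) j) - kernel_mean m k \<partial>law_power m)"
      by (intro Bochner_Integration.integral_sum Bochner_Integration.integrable_diff int_proj
          P.integrable_const) (simp only: lessThan_iff)
    also have "\<dots> = (\<Sum>j<m. (\<integral>y. kernel_proj m k j ((y(l := x)) j) \<partial>law_power m) - kernel_mean m k)"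
    proof (rule sum.cong[OF refl])
      fix j assume "j \<in> {..<m}"
      then have "integrable (law_power m) (\<lambda>y. kernel_proj m k j ((y(l := x)) j))"
        by (intro int_proj) simp
      from Bochner_Integration.integral_diff[OF this P.integrable_const]
      show "(\<integral>y. kernel_proj m k j ((y(l := x)) j) - kernel_mean m k \<partial>law_power m)
        = (\<integral>y. kernel_proj m k j ((y(l := x)) j) \<partial>law_power m) - kernel_mean m k"
        by (simp add: P.prob_space del: fun_upd_apply)
    qed
    finally show ?thesis .
  qed
  also have "\<dots> = kernel_proj m k l x - kernel_mean m k
      - (\<Sum>j<m. if j = l then kernel_proj m k l x - kernel_mean m k else 0)"
    unfolding kernel_proj_def[of m k l x, symmetric]
    by (intro arg_cong2[where f = "(-)"] sum.cong refl) (simp add: proj del: fun_upd_apply)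
  also have "\<dots> = 0" using l by simp
  finally show "(\<integral>y. kernel_remainder (y(l := x)) \<partial>law_power m) = 0" .
qed

text \<open>
  Each index occurs equally often at each position, so averaging the projections over all tuples gives an
  ordinary mean over the sample. The centred U-statistic is therefore that mean plus
  the average of a degenerate kernel.
\<close>

lemma U_stat_remainder:
  assumes "m \<le> n" "0 < n"
  shows "(\<Sum>xs\<in>tuples n m. kernel_remainder (X_sample xs \<omega>)) / real (card (tuples n m))
    = U_stat m k n \<omega> - kernel_mean m k - (\<Sum>i<n. hajek_proj m k (X i \<omega>)) / real n"
proof -
  let ?T = "tuples n m" and ?\<theta> = "kernel_mean m k"
  have "[0..<m] \<in> ?T" using \<open>m \<le> n\<close> by (auto simp: tuples_def)
  then have N: "card ?T > 0" using finite_tuples by (auto simp: card_gt_0_iff)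
  have "(\<Sum>xs\<in>?T. \<Sum>j<m. kernel_proj m k j (X_sample xs \<omega> j) - ?\<theta>)
      = (\<Sum>j<m. \<Sum>xs\<in>?T. kernel_proj m k j (X (xs ! j) \<omega>) - ?\<theta>)"
    by (subst sum.swap) (auto intro!: sum.cong simp: sample_def tuples_def)
  also have "\<dots> = (\<Sum>j<m. \<Sum>i<n. real (card ?T) / real n * (kernel_proj m k j (X i \<omega>) - ?\<theta>))"
  proof (rule sum.cong[OF refl])
    fix j assume j: "j \<in> {..<m}"
    have "(\<Sum>xs\<in>?T. kernel_proj m k j (X (xs ! j) \<omega>) - ?\<theta>)
        = (\<Sum>i<n. \<Sum>xs\<in>{xs \<in> ?T. xs ! j = i}. kernel_proj m k j (X (xs ! j) \<omega>) - ?\<theta>)"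
      using j by (intro sum.group[symmetric] finite_tuples) (auto simp: nth_tuple_less)
    also have "\<dots> = (\<Sum>i<n. real (card {xs \<in> ?T. xs ! j = i}) * (kernel_proj m k j (X i \<omega>) - ?\<theta>))"
      by (intro sum.cong refl) simp
    also have "\<dots> = (\<Sum>i<n. real (card ?T) / real n * (kernel_proj m k j (X i \<omega>) - ?\<theta>))"
    proof (intro sum.cong refl arg_cong2[where f = "(*)"])
      fix i assume "i \<in> {..<n}"
      then have "n * card {xs \<in> ?T. xs ! j = i} = card ?T"
        using card_tuples_nth[of j m i n] j by simp
      from arg_cong[OF this, of real]
      show "real (card {xs \<in> ?T. xs ! j = i}) = real (card ?T) / real n"
        using \<open>0 < n\<close> by (simp add: field_simps)
    qed
    finally show "(\<Sum>xs\<in>?T. kernel_proj m k j (X (xs ! j) \<omega>) - ?\<theta>)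
      = (\<Sum>i<n. real (card ?T) / real n * (kernel_proj m k j (X i \<omega>) - ?\<theta>))" .
  qed
  also have "\<dots> = real (card ?T) * ((\<Sum>i<n. hajek_proj m k (X i \<omega>)) / real n)"
    unfolding hajek_proj_def by (subst sum.swap) (simp add: sum_distrib_left sum_divide_distrib)
  finally have "(\<Sum>xs\<in>?T. kernel_remainder (X_sample xs \<omega>))
      = (\<Sum>xs\<in>?T. k (X_sample xs \<omega>)) - real (card ?T) * ?\<theta>
        - real (card ?T) * ((\<Sum>i<n. hajek_proj m k (X i \<omega>)) / real n)"
    by (simp add: kernel_remainder_def sum_subtractf)
  then show ?thesis
    using N by (simp add: U_stat_def diff_divide_distrib)
qed

lemma U_stat_hajek_error:
  assumes n: "2 \<le> n" and "m \<le> n" and "0 < m"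
  shows "expectation (\<lambda>\<omega>. (U_stat m k n \<omega> - kernel_mean m k - (\<Sum>i<n. hajek_proj m k (X i \<omega>)) / real n)\<^sup>2)
    \<le> (2 * (real m + 1) * b)\<^sup>2 * real m ^ 4 / (real n * (real n - 1))"
proof -
  let ?T = "tuples n m"
  have "[0..<m] \<in> ?T" using \<open>m \<le> n\<close> by (auto simp: tuples_def)
  then have N: "card ?T > 0" using finite_tuples by (auto simp: card_gt_0_iff)
  have "expectation (\<lambda>\<omega>. (U_stat m k n \<omega> - kernel_mean m k - (\<Sum>i<n. hajek_proj m k (X i \<omega>)) / real n)\<^sup>2)
    = expectation (\<lambda>\<omega>. (\<Sum>xs\<in>?T. kernel_remainder (X_sample xs \<omega>))\<^sup>2) / (real (card ?T))\<^sup>2"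
    using n \<open>m \<le> n\<close> by (subst U_stat_remainder[symmetric]) (auto simp: power_divide)
  also have "\<dots> \<le> (2 * (real m + 1) * b)\<^sup>2 * (real m ^ 4 * (real (card ?T))\<^sup>2 / (real n * (real n - 1))) / (real (card ?T))\<^sup>2"
    by (intro divide_right_mono degenerate_sum_second_moment abs_kernel_remainder_le
        degenerate_kernel_remainder n \<open>0 < m\<close>) auto
  also have "\<dots> = (2 * (real m + 1) * b)\<^sup>2 * real m ^ 4 / (real n * (real n - 1))"
    using N by simp
  finally show ?thesis .
qed

end

lemma expectation_abs_le_sqrt:
  fixes Y :: "'a \<Rightarrow> real"
  assumes "integrable M Y" "integrable M (\<lambda>\<omega>. (Y \<omega>)\<^sup>2)"
  shows "expectation (\<lambda>\<omega>. \<bar>Y \<omega>\<bar>) \<le> sqrt (expectation (\<lambda>\<omega>. (Y \<omega>)\<^sup>2))"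
proof -
  have "0 \<le> variance (\<lambda>\<omega>. \<bar>Y \<omega>\<bar>)" by simp
  also have "\<dots> = expectation (\<lambda>\<omega>. (Y \<omega>)\<^sup>2) - (expectation (\<lambda>\<omega>. \<bar>Y \<omega>\<bar>))\<^sup>2"
    using assms by (subst variance_eq) auto
  finally show ?thesis by (intro real_le_rsqrt) simp
qed

text \<open>
  Hoeffding's theorem for bounded kernels: scaled by \<open>\<surd>n\<close>, the degenerate remainder has a second moment
  of order \<open>1 / n\<close>, and the Hajek projection obeys the classical central limit theorem.
\<close>

theorem U_stat_clt:
  assumes k [measurable]: "k \<in> borel_measurable (law_power m)" and kb: "\<And>y. \<bar>k y\<bar> \<le> b"
    and "0 < m" and \<sigma>: "0 < \<sigma>" and var: "(\<integral>x. (hajek_proj m k x)\<^sup>2 \<partial>\<mu>) = \<sigma>\<^sup>2"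
  shows "weak_conv_m (\<lambda>n. distr M borel (\<lambda>\<omega>. sqrt (real n) * (U_stat m k n \<omega> - kernel_mean m k)))
           (density lborel (normal_density 0 \<sigma>))"
proof -
  let ?h = "hajek_proj m k"
  let ?A = "\<lambda>n \<omega>. sqrt (real n) * (U_stat m k n \<omega> - kernel_mean m k)"
  let ?B = "\<lambda>n \<omega>. (\<Sum>i<n. ?h (X i \<omega>)) / sqrt (real n)"
  let ?D = "\<lambda>n \<omega>. U_stat m k n \<omega> - kernel_mean m k - (\<Sum>i<n. ?h (X i \<omega>)) / real n"
  have hb: "\<bar>?h x\<bar> \<le> 2 * real m * b" for x by (rule abs_hajek_proj_le[OF k kb])
  have hint: "integrable \<mu> ?h" by (rule law.integrable_const_bound) (use hb in auto)
  have AB: "?A n \<omega> - ?B n \<omega> = sqrt (real n) * ?D n \<omega>" for n \<omega>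
  proof (cases "n = 0")
    case False
    then have "(\<Sum>i<n. ?h (X i \<omega>)) / sqrt (real n) = sqrt (real n) * ((\<Sum>i<n. ?h (X i \<omega>)) / real n)"
      by (simp add: real_div_sqrt field_simps flip: power2_eq_square)
    then show ?thesis by (simp add: algebra_simps)
  qed simp
  have Db: "\<exists>c. \<forall>\<omega>. \<bar>?D n \<omega>\<bar> \<le> c" for n
  proof -
    have U: "\<bar>U_stat m k n \<omega>\<bar> \<le> (\<Sum>xs\<in>tuples n m. b) / real (card (tuples n m))" for \<omega>
      unfolding U_stat_def abs_divide
      by (simp only: abs_of_nat, intro divide_right_mono order_trans[OF sum_abs] sum_mono kb) simp
    have H: "\<bar>(\<Sum>i<n. ?h (X i \<omega>)) / real n\<bar> \<le> (\<Sum>i<n. 2 * real m * b) / real n" for \<omega>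
      unfolding abs_divide by (simp only: abs_of_nat, intro divide_right_mono order_trans[OF sum_abs] sum_mono hb) simp
    have "\<bar>?D n \<omega>\<bar> \<le> (\<Sum>xs\<in>tuples n m. b) / real (card (tuples n m)) + \<bar>kernel_mean m k\<bar>
        + (\<Sum>i<n. 2 * real m * b) / real n" for \<omega>
      using U[of \<omega>] H[of \<omega>] by linarith
    then show ?thesis by blast
  qed
  have Dint: "integrable M (?D n)" "integrable M (\<lambda>\<omega>. (?D n \<omega>)\<^sup>2)" for n
  proof -
    obtain c where c: "\<And>\<omega>. \<bar>?D n \<omega>\<bar> \<le> c" using Db[of n] by blast
    show "integrable M (?D n)" by (rule integrable_const_bound[of _ c]) (use c in auto)
    show "integrable M (\<lambda>\<omega>. (?D n \<omega>)\<^sup>2)"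
      by (rule integrable_const_bound[of _ "c\<^sup>2"]) (use power_mono[OF c abs_ge_zero, of _ 2] in simp_all)
  qed
  show ?thesis
  proof (rule weak_conv_of_expectation_diff_tendsto_zero[where B = ?B])
    show "eventually (\<lambda>n. integrable M (\<lambda>\<omega>. \<bar>?A n \<omega> - ?B n \<omega>\<bar>)) sequentially"
      unfolding AB by (intro always_eventually allI integrable_abs integrable_mult_right Dint)
    let ?C = "(2 * (real m + 1) * b)\<^sup>2 * real m ^ 4"
    have bound: "norm (expectation (\<lambda>\<omega>. \<bar>?A n \<omega> - ?B n \<omega>\<bar>)) \<le> sqrt (?C / (real n - 1))"
      if n: "n \<ge> max 2 m" for n
    proof -
      have "norm (expectation (\<lambda>\<omega>. \<bar>?A n \<omega> - ?B n \<omega>\<bar>)) = expectation (\<lambda>\<omega>. \<bar>?A n \<omega> - ?B n \<omega>\<bar>)"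
        by simp
      also have "\<dots> = sqrt (real n) * expectation (\<lambda>\<omega>. \<bar>?D n \<omega>\<bar>)"
        unfolding AB by (simp add: abs_mult)
      also have "\<dots> \<le> sqrt (real n) * sqrt (expectation (\<lambda>\<omega>. (?D n \<omega>)\<^sup>2))"
        by (intro mult_left_mono expectation_abs_le_sqrt Dint) auto
      also have "\<dots> \<le> sqrt (real n) * sqrt (?C / (real n * (real n - 1)))"
        using n by (intro mult_left_mono real_sqrt_le_mono U_stat_hajek_error[OF k kb] \<open>0 < m\<close>) auto
      also have "\<dots> = sqrt (?C / (real n - 1))"
        using n by (subst real_sqrt_mult[symmetric]) simp
      finally show ?thesis .
    qed
    have lim: "(\<lambda>n. sqrt (c / (real n - 1))) \<longlonglongrightarrow> 0" for c :: real
    proof -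
      have "(\<lambda>n. c / (real n - 1)) \<longlonglongrightarrow> 0"
        by (intro tendsto_divide_0[OF tendsto_const] filterlim_at_top_imp_at_infinity
            filterlim_tendsto_add_at_top[of "\<lambda>_. -1" "-1", simplified] filterlim_real_sequentially)
      from tendsto_real_sqrt[OF this] show ?thesis by simp
    qed
    show "(\<lambda>n. expectation (\<lambda>\<omega>. \<bar>?A n \<omega> - ?B n \<omega>\<bar>)) \<longlonglongrightarrow> 0"
      by (rule Lim_null_comparison[OF eventually_sequentiallyI[OF bound] lim])
    show "weak_conv_m (\<lambda>n. distr M borel (?B n)) (density lborel (normal_density 0 \<sigma>))"
    proof (rule central_limit_theorem_normal)
      show "indep_vars (\<lambda>_. borel) (\<lambda>i \<omega>. ?h (X i \<omega>)) UNIV"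
        by (rule indep_vars_compose2[OF indep]) simp
      show "expectation (\<lambda>\<omega>. ?h (X i \<omega>)) = 0" for i
        using integral_distr[of "X i" M \<mu> ?h] integral_hajek_proj[OF k kb] by (simp add: law)
      show "integrable M (\<lambda>\<omega>. (?h (X i \<omega>))\<^sup>2)" for i
        by (rule integrable_const_bound[of _ "(2 * real m * b)\<^sup>2"])
           (use hb in \<open>auto simp: abs_le_square_iff[symmetric] intro: order_trans[OF _ abs_ge_self]\<close>)
      show "expectation (\<lambda>\<omega>. (?h (X i \<omega>))\<^sup>2) = \<sigma>\<^sup>2" for i
        using integral_distr[of "X i" M \<mu> "\<lambda>x. (?h x)\<^sup>2"] var by (simp add: law)
      show "distr M borel (\<lambda>\<omega>. ?h (X i \<omega>)) = distr \<mu> borel ?h" for i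
        using distr_distr[of ?h \<mu> borel "X i" M] by (simp add: law o_def)
    qed (rule \<sigma>)
  qed (auto intro: real_distribution_normal[OF \<sigma>])
qed

end

section \<open>Order statistics and the reduction to a U-statistic\<close>

lemma sorted_nth_le_iff:
  fixes t :: "'a::linorder"
  shows "sorted xs \<Longrightarrow> k < length xs \<Longrightarrow> xs ! k \<le> t \<longleftrightarrow> k < length (filter (\<lambda>y. y \<le> t) xs)"
proof (induction xs arbitrary: k)
  case (Cons a xs)
  show ?case
  proof (cases "a \<le> t")
    case True
    then show ?thesis using Cons by (cases k) auto
  next
    case False
    have "\<forall>y\<in>set (a # xs). a \<le> y" using Cons.prems(1) by simp
    then have "\<forall>y\<in>set (a # xs). \<not> y \<le> t" using False by (meson order_trans)
    then have "filter (\<lambda>y. y \<le> t) (a # xs) = []" "\<not> (a # xs) ! k \<le> t"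
      using Cons.prems(2) by (simp_all only: filter_empty_conv nth_mem) auto
    then show ?thesis by simp
  qed
qed simp

text \<open>
  The sorted list in the definition of an order statistic does not show that it is measurable; counts of
  observations below a threshold do.
\<close>

lemma order_statistic_le_iff:
  assumes "finite J" "0 < s" "s \<le> card J"
  shows "order_statistic s J x \<le> t \<longleftrightarrow> s \<le> card {j \<in> J. x j \<le> t}"
proof -
  let ?L = "sorted_list_of_multiset (image_mset x (mset_set J))"
  have "length ?L = card J" by (metis mset_sorted_list_of_multiset size_image_mset size_mset size_mset_set)
  moreover have "length (filter (\<lambda>y. y \<le> t) ?L) = card {j \<in> J. x j \<le> t}"
  proof -
    have "length (filter (\<lambda>y. y \<le> t) ?L) = size (filter_mset (\<lambda>y. y \<le> t) (mset ?L))"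
      by (metis mset_filter size_mset)
    then show ?thesis
      using assms(1) by (simp add: filter_mset_image_mset filter_mset_mset_set)
  qed
  ultimately show ?thesis
    using sorted_nth_le_iff[of ?L "s - 1" t] assms
    by (auto simp: order_statistic_def)
qed

lemma borel_measurable_order_statistic [measurable (raw)]:
  assumes "finite J" "0 < s" "s \<le> card J" and [measurable]: "\<And>i. X i \<in> borel_measurable M"
  shows "(\<lambda>\<omega>. order_statistic s J (\<lambda>i. X i \<omega>)) \<in> borel_measurable M"
proof (rule borel_measurableI_le)
  fix t
  have c: "real (card {j \<in> J. x j \<le> t}) = (\<Sum>j\<in>J. indicator {..t} (x j))" for x :: "nat \<Rightarrow> real"
    using assms(1) by (simp add: indicator_def sum.If_cases Int_def)
  have "{\<omega> \<in> space M. order_statistic s J (\<lambda>i. X i \<omega>) \<le> t}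
      = {\<omega> \<in> space M. real s \<le> (\<Sum>j\<in>J. indicator {..t} (X j \<omega>))}"
    unfolding c[symmetric] by (simp add: order_statistic_le_iff[OF assms(1-3)])
  also have "\<dots> \<in> sets M" by measurable
  finally show "{\<omega> \<in> space M. order_statistic s J (\<lambda>i. X i \<omega>) \<le> t} \<in> sets M" .
qed

lemma borel_measurable_I4_stat:
  assumes [measurable]: "\<And>i. X i \<in> borel_measurable M"
  shows "(\<lambda>\<omega>. I4_stat n (\<lambda>i. X i \<omega>)) \<in> borel_measurable M"
proof -
  have [measurable]: "(\<lambda>\<omega>. order_statistic s J (\<lambda>i. X i \<omega>)) \<in> borel_measurable M"
    if "s \<in> {3, 4}" "J \<in> {J. J \<subseteq> {..<n} \<and> card J = 4}" for s J
    using that by (intro borel_measurable_order_statistic assms) (auto intro: finite_subset)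
  show ?thesis
    unfolding I4_stat_def H_emp_def F_emp_def of_bool_def by measurable
qed

lemma order_statistic_strictly_sorted:
  assumes "sorted_wrt (\<lambda>i j. x j < x i) [a, b, c, d]"
  shows "order_statistic 4 {a, b, c, d} x = x a" "order_statistic 3 {a, b, c, d} x = x b"
proof -
  have "image_mset x (mset_set {a, b, c, d}) = mset [x d, x c, x b, x a]"
  proof -
    have "distinct [a, b, c, d]" using assms by auto
    from mset_set_set[OF this] show ?thesis by simp
  qed
  moreover have "sorted [x d, x c, x b, x a]" using assms by auto
  ultimately have "sorted_list_of_multiset (image_mset x (mset_set {a, b, c, d})) = [x d, x c, x b, x a]"
    by (simp only: sorted_list_of_multiset_mset sorted_sort_id)
  then show "order_statistic 4 {a, b, c, d} x = x a" "order_statistic 3 {a, b, c, d} x = x b"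
    by (simp_all add: order_statistic_def)
qed

text \<open>
  Turns sums over index sets into sums over tuples: in the absence of ties, each set of indices can be
  sorted by its observations in exactly one way.
\<close>

lemma bij_betw_set_sorted_tuples:
  fixes u :: "nat \<Rightarrow> 'b::linorder"
  assumes "inj_on u {..<n}"
  shows "bij_betw set {xs \<in> tuples n m. sorted_wrt (<) (map u xs)} {J. J \<subseteq> {..<n} \<and> card J = m}"
proof (rule bij_betw_imageI)
  show "inj_on set {xs \<in> tuples n m. sorted_wrt (<) (map u xs)}"
  proof (rule inj_onI)
    fix xs ys
    assume xs: "xs \<in> {xs \<in> tuples n m. sorted_wrt (<) (map u xs)}"
      and ys: "ys \<in> {xs \<in> tuples n m. sorted_wrt (<) (map u xs)}" and eq: "set xs = set ys"
    have "map u xs = map u ys"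
      using xs ys eq by (intro strict_sorted_equal) auto
    then show "xs = ys"
      using inj_on_map_eq_map[of u xs ys] inj_on_subset[OF assms, of "set xs \<union> set ys"] xs ys
      by (auto simp: tuples_def)
  qed
  show "set ` {xs \<in> tuples n m. sorted_wrt (<) (map u xs)} = {J. J \<subseteq> {..<n} \<and> card J = m}" (is "?L = ?R")
  proof
    show "?L \<subseteq> ?R" by (auto simp: tuples_def distinct_card)
    show "?R \<subseteq> ?L"
    proof
      fix J assume J: "J \<in> ?R"
      then have fin: "finite J" by (auto intro: finite_subset)
      have inj: "inj_on u J" using J by (intro inj_on_subset[OF assms]) auto
      define xs where "xs = map (inv_into J u) (sorted_list_of_set (u ` J))"
      have set: "set xs = J" using fin inj by (simp add: xs_def image_comp)
      have "map u xs = sorted_list_of_set (u ` J)"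
        unfolding xs_def map_map by (rule map_idI) (simp add: fin f_inv_into_f)
      then have "sorted_wrt (<) (map u xs)" by simp
      moreover have "length xs = m"
        using J inj by (simp add: xs_def card_image)
      ultimately show "J \<in> ?L"
        using J set by (intro image_eqI[of _ _ xs]) (auto simp: tuples_def card_distinct)
    qed
  qed
qed

lemma bij_betw_append_tuples:
  "bij_betw (\<lambda>(xs, i). xs @ [i]) (SIGMA xs:tuples n m. {..<n} - set xs) (tuples n (Suc m))"
proof (rule bij_betw_imageI)
  show "inj_on (\<lambda>(xs, i). xs @ [i]) (SIGMA xs:tuples n m. {..<n} - set xs)"
    by (auto simp: inj_on_def)
  show "(\<lambda>(xs, i). xs @ [i]) ` (SIGMA xs:tuples n m. {..<n} - set xs) = tuples n (Suc m)" (is "?L = ?R")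
  proof
    show "?L \<subseteq> ?R" by (auto simp: tuples_def)
    show "?R \<subseteq> ?L"
    proof
      fix zs assume zs: "zs \<in> ?R"
      then obtain xs i where "zs = xs @ [i]" by (cases zs rule: rev_cases) (auto simp: tuples_def)
      with zs show "zs \<in> ?L" by (intro image_eqI[of _ _ "(xs, i)"]) (auto simp: tuples_def)
    qed
  qed
qed

lemma card_tuples_Suc: "card (tuples n (Suc m)) = card (tuples n m) * (n - m)"
proof -
  have "card (tuples n (Suc m)) = card (SIGMA xs:tuples n m. {..<n} - set xs)"
    using bij_betw_same_card[OF bij_betw_append_tuples] by simp
  also have "\<dots> = (\<Sum>xs\<in>tuples n m. card ({..<n} - set xs))"
    by (rule card_SigmaI) (auto simp: finite_tuples)
  also have "\<dots> = (\<Sum>xs\<in>tuples n m. n - m)"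
    by (intro sum.cong refl) (auto simp: tuples_def card_Diff_subset distinct_card)
  finally show ?thesis by simp
qed

lemma card_tuples: "card (tuples n m) = fact m * (n choose m)"
proof (induction m)
  case 0
  have "tuples n 0 = {[]}" by (auto simp: tuples_def)
  then show ?case by simp
next
  case (Suc m)
  have "(n choose m) * (n - m) = Suc m * (n choose Suc m)"
    using binomial_absorb_comp[of n m] Suc_times_binomial[of m "n - 1"]
    by (cases n) (simp_all only: diff_Suc_1 mult.commute binomial_0_Suc mult_0 zero_diff)
  with Suc show ?case by (simp add: card_tuples_Suc algebra_simps)
qed

text \<open>
  Without ties the sum counts each unordered pair of distinct indices once, so the empirical
  distribution function contributes a constant.
\<close>

lemma sum_F_emp:
  assumes "inj_on x {..<n}" "0 < n"
  shows "(\<Sum>i<n. F_emp n x (x i)) = (real n - 1) / 2"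
proof -
  let ?S = "\<Sum>i<n. \<Sum>j<n. of_bool (x j < x i) :: real"
  have "?S + ?S = ?S + (\<Sum>i<n. \<Sum>j<n. of_bool (x i < x j))"
    by (subst (3) sum.swap) simp
  also have "\<dots> = (\<Sum>i<n. \<Sum>j<n. of_bool (x j < x i) + of_bool (x i < x j))"
    by (simp add: sum.distrib)
  also have "\<dots> = (\<Sum>i<n. \<Sum>j<n. 1 - of_bool (i = j))"
    using assms(1) by (intro sum.cong refl) (auto simp: inj_on_def of_bool_def not_less_iff_gr_or_eq)
  also have "\<dots> = (\<Sum>i<n. real n - 1)"
    by (intro sum.cong refl) (simp add: sum_subtractf of_bool_def)
  finally have "?S = real n * (real n - 1) / 2" by simp
  then show ?thesis using assms(2) by (simp add: F_emp_def flip: sum_divide_distrib)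
qed

text \<open>
  The kernel takes uniform variables \<open>u = x powr - lam\<close>, so its first two arguments stand for the
  largest and second largest of four observations, and \<open>v * b < a\<close> says that their ratio is below the
  fifth observation. Each four-element set is counted once because the four arguments have to be
  sorted; the factor 24 is the number of orders of four indices, so that averaging over all
  ordered tuples gives back the average over sets.
\<close>

definition spacing :: "real \<Rightarrow> real \<Rightarrow> real \<Rightarrow> real \<Rightarrow> real \<Rightarrow> real" where
  "spacing a b c d v = 24 * of_bool (a < b \<and> b < c \<and> c < d \<and> v * b < a)"

definition spacing_kernel :: "(nat \<Rightarrow> real) \<Rightarrow> real" where
  "spacing_kernel y = spacing (y 0) (y 1) (y 2) (y 3) (y 4)"

lemma sum_order_statistic_ratio:
  assumes lam: "0 < lam" and pos: "\<And>i. i < n \<Longrightarrow> 0 < x i" and inj: "inj_on x {..<n}"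
    and u: "u = (\<lambda>i. x i powr - lam)" and i: "i < n"
  shows "(\<Sum>J | J \<subseteq> {..<n} \<and> card J = 4. of_bool (order_statistic 4 J x / order_statistic 3 J x < x i))
    = (\<Sum>xs\<in>tuples n 4. spacing_kernel (sample u (xs @ [i])) / 24)"
proof -
  have less_iff: "u j < u k \<longleftrightarrow> x k < x j" if "j < n" "k < n" for j k
    using pos[OF that(1)] pos[OF that(2)] lam unfolding u
    by (metis neg_0_less_iff_less neg_less_0_iff_less not_less_iff_gr_or_eq powr_less_mono2_neg)
  have inju: "inj_on u {..<n}"
  proof (rule inj_onI)
    fix j k assume jk: "j \<in> {..<n}" "k \<in> {..<n}" and "u j = u k"
    then have "x j = x k" using less_iff[of j k] less_iff[of k j] by simp
    then show "j = k" using inj jk by (simp add: inj_on_eq_iff)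
  qed
  let ?T = "{xs \<in> tuples n 4. sorted_wrt (<) (map u xs)}"
  have "(\<Sum>J | J \<subseteq> {..<n} \<and> card J = 4. of_bool (order_statistic 4 J x / order_statistic 3 J x < x i))
    = (\<Sum>xs\<in>?T. of_bool (order_statistic 4 (set xs) x / order_statistic 3 (set xs) x < x i) :: real)"
    by (rule sum.reindex_bij_betw[OF bij_betw_set_sorted_tuples[OF inju], symmetric])
  also have "\<dots> = (\<Sum>xs\<in>?T. spacing_kernel (sample u (xs @ [i])) / 24)"
  proof (rule sum.cong[OF refl])
    fix xs assume "xs \<in> ?T"
    then obtain a b c d where xs: "xs = [a, b, c, d]" and n: "a < n" "b < n" "c < n" "d < n"
      and s: "u a < u b" "u b < u c" "u c < u d"
      by (auto simp: tuples_def eval_nat_numeral length_Suc_conv)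
    have "sorted_wrt (\<lambda>i j. x j < x i) [a, b, c, d]" using s n by (auto simp: less_iff)
    note os = order_statistic_strictly_sorted[OF this]
    have "x a / x b < x i \<longleftrightarrow> x a < x i * x b" using pos n by (simp add: field_simps)
    also have "\<dots> \<longleftrightarrow> (x i * x b) powr - lam < x a powr - lam"
      using pos n i lam
      by (metis neg_less_0_iff_less mult_pos_pos not_less_iff_gr_or_eq powr_less_mono2_neg)
    also have "(x i * x b) powr - lam = u i * u b"
      using pos n i by (simp add: u powr_mult)
    finally have "x a / x b < x i \<longleftrightarrow> u i * u b < u a" by (simp add: u)
    then show "of_bool (order_statistic 4 (set xs) x / order_statistic 3 (set xs) x < x i)
        = spacing_kernel (sample u (xs @ [i])) / 24"
      using s by (simp add: os xs spacing_kernel_def spacing_def sample_def)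
  qed
  also have "\<dots> = (\<Sum>xs\<in>tuples n 4. spacing_kernel (sample u (xs @ [i])) / 24)"
  proof (rule sum.mono_neutral_left)
    show "\<forall>xs\<in>tuples n 4 - ?T. spacing_kernel (sample u (xs @ [i])) / 24 = 0"
    proof
      fix xs assume xs: "xs \<in> tuples n 4 - ?T"
      then obtain a b c d where "xs = [a, b, c, d]"
        by (auto simp: tuples_def eval_nat_numeral length_Suc_conv)
      with xs show "spacing_kernel (sample u (xs @ [i])) / 24 = 0"
        by (auto simp: spacing_kernel_def spacing_def sample_def)
    qed
  qed (auto simp: finite_tuples)
  finally show ?thesis .
qed

text \<open>
  Summing over the sets \<open>J\<close> and the index \<open>i\<close> gives tuples of five distinct indices, except for the terms with
  \<open>i \<in> J\<close>, which are a fraction \<open>4 / n\<close> of all terms. That fraction, bounded crudely, and the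
  difference between \<open>(n - 1) / (2 n)\<close> and \<open>1 / 2\<close> account for the error.
\<close>

lemma I4_stat_approx:
  assumes lam: "0 < lam" and pos: "\<And>i. i < n \<Longrightarrow> 0 < x i" and inj: "inj_on x {..<n}"
    and u: "u = (\<lambda>i. x i powr - lam)" and n: "5 \<le> n"
  shows "\<bar>I4_stat n x - ((\<Sum>zs\<in>tuples n 5. spacing_kernel (sample u zs)) / real (card (tuples n 5)) - 1 / 2)\<bar>
    \<le> 100 / real n"
proof -
  let ?K = "\<lambda>xs i. spacing_kernel (sample u (xs @ [i])) / 24"
  let ?C = "real (n choose 4)"
  let ?mean = "(\<Sum>zs\<in>tuples n 5. spacing_kernel (sample u zs)) / real (card (tuples n 5))"
  \<comment> \<open>the terms in which the index of the threshold lies in the four-element set\<close>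
  define R where "R = (\<Sum>xs\<in>tuples n 4. \<Sum>i\<in>set xs. ?K xs i)"
  have n_pos: "0 < n" using n by simp
  have C: "?C > 0" using n by simp
  have N5: "real (card (tuples n 5)) = 24 * ?C * (real n - 4)"
    using arg_cong[OF card_tuples_Suc[of n 4], of real] n
    by (simp add: card_tuples[of n 4] fact_numeral of_nat_diff)
  have kb: "0 \<le> spacing_kernel y" "spacing_kernel y \<le> 24" for y by (auto simp: spacing_kernel_def spacing_def)
  have "(\<Sum>i<n. H_emp n x (x i)) * ?C = (\<Sum>i<n. \<Sum>xs\<in>tuples n 4. ?K xs i)"
  proof -
    have "H_emp n x (x i) * ?C = (\<Sum>xs\<in>tuples n 4. ?K xs i)" if "i < n" for i
    proof -
      have "(\<Sum>J | J \<subseteq> {..<n} \<and> card J = 4. of_bool (order_statistic 4 J x / order_statistic 3 J x < x i))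
          = (\<Sum>xs\<in>tuples n 4. ?K xs i)"
        by (rule sum_order_statistic_ratio[OF lam _ inj u that]) (rule pos)
      moreover have "s / ?C * ?C = s" for s :: real using C by simp
      ultimately show ?thesis unfolding H_emp_def by (simp only:)
    qed
    then show ?thesis unfolding sum_distrib_right by (intro sum.cong) simp_all
  qed
  also have "\<dots> = (\<Sum>xs\<in>tuples n 4. \<Sum>i<n. ?K xs i)" by (rule sum.swap)
  also have "\<dots> = (\<Sum>xs\<in>tuples n 4. (\<Sum>i\<in>{..<n} - set xs. ?K xs i) + (\<Sum>i\<in>set xs. ?K xs i))"
    by (intro sum.cong refl sum.subset_diff) (auto simp: tuples_def)
  also have "\<dots> = (\<Sum>(xs, i)\<in>(SIGMA xs:tuples n 4. {..<n} - set xs). ?K xs i) + R"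
    unfolding sum.distrib R_def by (subst sum.Sigma) (auto simp: finite_tuples)
  also have "(\<Sum>(xs, i)\<in>(SIGMA xs:tuples n 4. {..<n} - set xs). ?K xs i)
      = (\<Sum>zs\<in>tuples n 5. spacing_kernel (sample u zs) / 24)"
    using sum.reindex_bij_betw[OF bij_betw_append_tuples[of n 4], of "\<lambda>zs. spacing_kernel (sample u zs) / 24"]
    by (simp add: case_prod_unfold)
  also have "\<dots> = ?C * (real n - 4) * ?mean"
  proof -
    have "s / 24 = c * d * (s / (24 * c * d))" if "c \<noteq> 0" "d \<noteq> 0" for s c d :: real
      using that by simp
    from this[of ?C "real n - 4"] show ?thesis
      unfolding N5 sum_divide_distrib[symmetric] using C n by simp
  qed
  finally have H: "(\<Sum>i<n. H_emp n x (x i)) = (real n - 4) * ?mean + R / ?C"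
    using C by (simp add: field_simps)
  have mean: "0 \<le> ?mean" "?mean \<le> 24"
  proof -
    show "0 \<le> ?mean" by (intro divide_nonneg_nonneg sum_nonneg kb) auto
    have "(\<Sum>zs\<in>tuples n 5. spacing_kernel (sample u zs)) \<le> (\<Sum>zs\<in>tuples n 5. 24)"
      by (intro sum_mono kb)
    then show "?mean \<le> 24" using N5 C n by (simp add: divide_le_eq)
  qed
  have R0: "0 \<le> R" unfolding R_def by (intro sum_nonneg) (simp add: kb)
  have "R \<le> (\<Sum>xs\<in>tuples n 4. \<Sum>i\<in>set xs. 1)"
    unfolding R_def using kb(2) by (intro sum_mono) (simp add: field_simps)
  also have "\<dots> = (\<Sum>xs\<in>tuples n 4. 4)"
    by (intro sum.cong refl) (auto simp: tuples_def distinct_card)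
  also have "\<dots> = 96 * ?C" by (simp add: card_tuples fact_numeral)
  finally have R1: "R / ?C \<le> 96" using C by (simp add: field_simps)
  have "I4_stat n x = ((real n - 4) * ?mean + R / ?C - (real n - 1) / 2) / real n"
    by (simp add: I4_stat_def sum_subtractf H sum_F_emp[OF inj n_pos])
  also have "\<dots> - (?mean - 1 / 2) = (R / ?C - 4 * ?mean + 1 / 2) / real n"
  proof -
    have alg: "((N - 4) * m + r - (N - 1) / 2) / N - (m - 1 / 2) = (r - 4 * m + 1 / 2) / N"
      if "N \<noteq> 0" for N m r :: real
      using that by (simp add: field_simps)
    show ?thesis by (rule alg) (use n_pos in simp)
  qed
  finally have "I4_stat n x - (?mean - 1 / 2) = (R / ?C - 4 * ?mean + 1 / 2) / real n" .
  moreover have "\<bar>R / ?C - 4 * ?mean + 1 / 2\<bar> \<le> 100"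
  proof -
    have "0 \<le> R / ?C" using R0 C by simp
    then show ?thesis using R1 mean unfolding abs_le_iff by linarith
  qed
  ultimately show ?thesis
    by (simp only: abs_divide abs_of_nat divide_right_mono of_nat_0_le_iff)
qed

section \<open>Integrals of the kernel over uniform variables\<close>

abbreviation unif :: "real measure" where
  "unif \<equiv> uniform_measure lborel {0..1}"

interpretation unif: prob_space unif
  by (rule prob_space_uniform_measure) auto

interpretation unif_product: product_sigma_finite "\<lambda>_::nat. unif"
  by unfold_locales

lemma sets_unif [measurable_cong]: "sets unif = sets borel"
  by simp

lemma AE_unif: "AE x in unif. 0 < x \<and> x < 1"
proof -
  have "AE x in lborel. x \<noteq> (0::real)" "AE x in lborel. x \<noteq> (1::real)"
    by (rule AE_lborel_singleton)+
  then have "AE x in lborel. x \<in> {0..1} \<longrightarrow> 0 < x \<and> x < (1::real)" by eventually_elim auto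
  then show ?thesis by (subst AE_uniform_measure) auto
qed

text \<open>
  All integrals below have nonnegative integrands with explicit antiderivatives, supported on an interval
  at whose ends the antiderivative may fail to be differentiable. Agreement with the integrand is only asked
  in the open unit interval, where a uniform variable lies almost surely.
\<close>

lemma integral_unif_eqI:
  fixes f F g :: "real \<Rightarrow> real"
  assumes lr: "0 \<le> l" "l \<le> r" "r \<le> 1" and g [measurable]: "g \<in> borel_measurable borel"
    and eq: "\<And>x. 0 < x \<Longrightarrow> x < 1 \<Longrightarrow> g x = (if l < x \<and> x < r then f x else 0)"
    and nonneg: "\<And>x. l < x \<Longrightarrow> x < r \<Longrightarrow> 0 \<le> f x"
    and cont: "continuous_on {l..r} F"
    and deriv: "\<And>x. l < x \<Longrightarrow> x < r \<Longrightarrow> (F has_real_derivative f x) (at x)"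
  shows "(\<integral>x. g x \<partial>unif) = F r - F l"
proof -
  let ?G = "\<lambda>x. indicator {0<..<1} x * g x"
  let ?h = "\<lambda>x. if l < x \<and> x < r then f x else 0"
  have G: "?G = ?h" using eq lr by (auto simp: fun_eq_iff indicator_def)
  have "(f has_integral F r - F l) {l..r}"
    by (rule fundamental_theorem_of_calculus_interior[OF lr(2) cont])
       (use deriv in \<open>auto simp: has_real_derivative_iff_has_vector_derivative\<close>)
  then have "(?h has_integral F r - F l) {l..r}"
    by (rule has_integral_spike[of "{l, r}", rotated 2]) auto
  then have h: "(?h has_integral F r - F l) UNIV"
    by (rule has_integral_on_superset) auto
  have h0: "0 \<le> ?h x" for x using nonneg by auto
  have hm: "?h \<in> borel_measurable borel" unfolding G[symmetric] by measurable
  have "has_bochner_integral lborel ?h (F r - F l)"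
    using nn_integral_has_integral_lborel[OF hm h0 h] has_integral_nonneg[OF h] h0 hm
    by (intro has_bochner_integral_nn_integral) auto
  then have "has_bochner_integral lborel ?G (F r - F l)" by (simp only: G)
  then have "F r - F l = (\<integral>x. ?G x \<partial>lborel)" by (simp add: has_bochner_integral_integral_eq)
  also have "\<dots> = (\<integral>x. indicator {0..1} x * g x \<partial>lborel)"
  proof (rule integral_cong_AE)
    have "AE x in lborel. x \<noteq> (0::real)" "AE x in lborel. x \<noteq> (1::real)"
      by (rule AE_lborel_singleton)+
    then show "AE x in lborel. indicator {0<..<1} x * g x = indicator {0..1} x * g x"
      by eventually_elim (auto simp: indicator_def)
  qed auto
  also have "\<dots> = (\<integral>x. g x \<partial>unif)"
  proof -
    have "unif = density lborel (\<lambda>x. ennreal (indicator {0..1} x))"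
      by (simp add: uniform_measure_def ennreal_indicator divide_ennreal_def)
    then show ?thesis by (simp add: integral_real_density)
  qed
  finally show ?thesis ..
qed

lemma integral_PiM_unif_insert:
  fixes g :: "(nat \<Rightarrow> real) \<Rightarrow> real"
  assumes I: "finite I" "i \<notin> I" and g: "g \<in> borel_measurable (PiM (insert i I) (\<lambda>_. unif))"
    and b: "\<And>y. \<bar>g y\<bar> \<le> b"
  shows "(\<integral>y. g y \<partial>PiM (insert i I) (\<lambda>_. unif)) = (\<integral>y. (\<integral>t. g (y(i := t)) \<partial>unif) \<partial>PiM I (\<lambda>_. unif))"
    and "(\<lambda>y. \<integral>t. g (y(i := t)) \<partial>unif) \<in> borel_measurable (PiM I (\<lambda>_. unif))"
    and "\<bar>\<integral>t. g (y(i := t)) \<partial>unif\<bar> \<le> b"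
proof -
  interpret P: prob_space "PiM (insert i I) (\<lambda>_. unif)"
    by (rule prob_space_PiM) (rule unif.prob_space_axioms)
  note [measurable] = g
  show "(\<integral>y. g y \<partial>PiM (insert i I) (\<lambda>_. unif)) = (\<integral>y. (\<integral>t. g (y(i := t)) \<partial>unif) \<partial>PiM I (\<lambda>_. unif))"
    by (rule unif_product.product_integral_insert[OF I P.integrable_const_bound[of _ b]]) (auto simp: b)
  have [measurable]: "(\<lambda>(y, t). y(i := t)) \<in> measurable (PiM I (\<lambda>_. unif) \<Otimes>\<^sub>M unif) (PiM (insert i I) (\<lambda>_. unif))"
    unfolding case_prod_unfold by (intro measurable_fun_upd[where J = I]) auto
  show "(\<lambda>y. \<integral>t. g (y(i := t)) \<partial>unif) \<in> borel_measurable (PiM I (\<lambda>_. unif))"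
    by measurable
  show "\<bar>\<integral>t. g (y(i := t)) \<partial>unif\<bar> \<le> b"
    by (rule abs_expectation_le) (auto simp: b unif.prob_space_axioms)
qed

text \<open>
  The order of integration suits the spacing kernel: the ratio of coordinates 0 and 1 bounds
  coordinate 4, and coordinates 2 and 3 are only bounded below, so these three are integrated first.
\<close>

lemma integral_unif_5:
  fixes g :: "(nat \<Rightarrow> real) \<Rightarrow> real"
  assumes g: "g \<in> borel_measurable (PiM {..<5} (\<lambda>_. unif))" and b: "\<And>y. \<bar>g y\<bar> \<le> b"
  shows "(\<integral>y. g y \<partial>PiM {..<5} (\<lambda>_. unif)) =
    (\<integral>b. (\<integral>a. (\<integral>c. (\<integral>d. (\<integral>v. g ((\<lambda>_. undefined)(1 := b, 0 := a, 2 := c, 3 := d, 4 := v))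
      \<partial>unif) \<partial>unif) \<partial>unif) \<partial>unif) \<partial>unif)"
proof -
  have I: "{..<5::nat} = insert 4 (insert 3 (insert 2 (insert 0 (insert 1 {}))))"
    by auto
  note g4 = integral_PiM_unif_insert[OF _ _ g[unfolded I] b]
  note g3 = integral_PiM_unif_insert[OF _ _ g4(2) g4(3)]
  note g2 = integral_PiM_unif_insert[OF _ _ g3(2) g3(3)]
  note g0 = integral_PiM_unif_insert[OF _ _ g2(2) g2(3)]
  note g1 = integral_PiM_unif_insert[OF _ _ g0(2) g0(3)]
  have "(\<integral>y. g y \<partial>PiM {..<5} (\<lambda>_. unif))
      = (\<integral>y. \<integral>v. g (y(4 := v)) \<partial>unif \<partial>PiM {3, 2, 0, 1} (\<lambda>_. unif))"
    unfolding I by (rule g4(1)) auto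
  also have "\<dots> = (\<integral>y. \<integral>d. \<integral>v. g (y(3 := d, 4 := v)) \<partial>unif \<partial>unif \<partial>PiM {2, 0, 1} (\<lambda>_. unif))"
    by (rule g3(1)) auto
  also have "\<dots> = (\<integral>y. \<integral>c. \<integral>d. \<integral>v. g (y(2 := c, 3 := d, 4 := v)) \<partial>unif \<partial>unif \<partial>unif
      \<partial>PiM {0, 1} (\<lambda>_. unif))"
    by (rule g2(1)) auto
  also have "\<dots> = (\<integral>y. \<integral>a. \<integral>c. \<integral>d. \<integral>v. g (y(0 := a, 2 := c, 3 := d, 4 := v))
      \<partial>unif \<partial>unif \<partial>unif \<partial>unif \<partial>PiM {1} (\<lambda>_. unif))"
    by (rule g0(1)) auto
  also have "\<dots> = (\<integral>y. \<integral>b. \<integral>a. \<integral>c. \<integral>d. \<integral>v. g (y(1 := b, 0 := a, 2 := c, 3 := d, 4 := v))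
      \<partial>unif \<partial>unif \<partial>unif \<partial>unif \<partial>unif \<partial>PiM {} (\<lambda>_. unif))"
    by (rule g1(1)) auto
  also have "\<dots> = (\<integral>b. \<integral>a. \<integral>c. \<integral>d. \<integral>v. g ((\<lambda>_. undefined)(1 := b, 0 := a, 2 := c, 3 := d, 4 := v))
      \<partial>unif \<partial>unif \<partial>unif \<partial>unif \<partial>unif)"
    by (simp only: PiM_empty) (simp add: lebesgue_integral_count_space_finite del: fun_upd_apply)
  finally show ?thesis .
qed

lemma spacing_measurable [measurable (raw)]:
  assumes [measurable]: "a \<in> borel_measurable M" "b \<in> borel_measurable M" "c \<in> borel_measurable M"
    "d \<in> borel_measurable M" "v \<in> borel_measurable M"
  shows "(\<lambda>x. spacing (a x) (b x) (c x) (d x) (v x)) \<in> borel_measurable M"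
  unfolding spacing_def of_bool_def by measurable

lemma spacing_kernel_measurable: "spacing_kernel \<in> borel_measurable (PiM {..<5} (\<lambda>_. unif))"
proof -
  have [measurable]: "(\<lambda>y. y i) \<in> borel_measurable (PiM {..<5} (\<lambda>_. unif))" if "i < 5" for i :: nat
    using measurable_component_singleton[of i "{..<5}" "\<lambda>_. unif"] that by simp
  show ?thesis unfolding spacing_kernel_def[abs_def] by measurable
qed

lemma abs_spacing_kernel_le: "\<bar>spacing_kernel y\<bar> \<le> 24"
  by (simp add: spacing_kernel_def spacing_def)

text \<open>
  The iterated integrals start with the threshold \<open>v\<close>, which turns the condition \<open>v * b < a\<close> into
  the factor \<open>a / b\<close>, and continue with \<open>d\<close> and \<open>c\<close>. The variants that skip one of these variables serve
  the projections, which fix one argument of the kernel.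
\<close>

lemma integral_spacing_v:
  assumes "0 < a" "0 < b"
  shows "(\<integral>v. spacing a b c d v \<partial>unif) = of_bool (a < b \<and> b < c \<and> c < d) * (24 * (a / b))"
proof (cases "a < b \<and> b < c \<and> c < d")
  case True
  have "(\<integral>v. spacing a b c d v \<partial>unif) = 24 * (a / b) - 24 * 0"
    by (rule integral_unif_eqI[where l = 0 and r = "a / b" and F = "\<lambda>v. 24 * v" and f = "\<lambda>_. 24"])
       (use True assms in \<open>auto simp: spacing_def field_simps intro!: continuous_intros derivative_eq_intros\<close>)
  then show ?thesis using True by simp
qed (auto simp: spacing_def)

lemma integral_spacing_dv:
  assumes "0 < a" "0 < b" "0 < c" "c < 1"
  shows "(\<integral>d. \<integral>v. spacing a b c d v \<partial>unif \<partial>unif) = of_bool (a < b \<and> b < c) * (24 * (a / b) * (1 - c))"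
proof (cases "a < b \<and> b < c")
  case True
  have "(\<integral>d. \<integral>v. spacing a b c d v \<partial>unif \<partial>unif) = 24 * (a / b) * 1 - 24 * (a / b) * c"
    by (rule integral_unif_eqI[where l = c and r = 1 and F = "\<lambda>d. 24 * (a / b) * d" and f = "\<lambda>_. 24 * (a / b)"])
       (use True assms in \<open>auto simp: integral_spacing_v intro!: continuous_intros derivative_eq_intros\<close>)
  also have "\<dots> = of_bool (a < b \<and> b < c) * (24 * (a / b) * (1 - c))"
    using True by (simp add: right_diff_distrib)
  finally show ?thesis .
qed (use assms in \<open>auto simp: integral_spacing_v\<close>)

lemma integral_spacing_cdv:
  assumes "0 < a" "0 < b" "b < 1"
  shows "(\<integral>c. \<integral>d. \<integral>v. spacing a b c d v \<partial>unif \<partial>unif \<partial>unif) = of_bool (a < b) * (12 * (a / b) * (1 - b)\<^sup>2)"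
proof -
  have "(\<integral>c. \<integral>d. \<integral>v. spacing a b c d v \<partial>unif \<partial>unif \<partial>unif)
      = of_bool (a < b) * (- 12 * (a / b) * (1 - 1)\<^sup>2) - of_bool (a < b) * (- 12 * (a / b) * (1 - b)\<^sup>2)"
  proof (rule integral_unif_eqI[where f = "\<lambda>c. of_bool (a < b) * (24 * (a / b) * (1 - c))"
        and l = b and r = 1 and F = "\<lambda>c. of_bool (a < b) * (- 12 * (a / b) * (1 - c)\<^sup>2)"])
    show "((\<lambda>c. of_bool (a < b) * (- 12 * (a / b) * (1 - c)\<^sup>2)) has_real_derivative
        of_bool (a < b) * (24 * (a / b) * (1 - c))) (at c)" for c
      by (rule derivative_eq_intros refl | simp)+ (use assms in \<open>simp add: field_simps\<close>)
  qed (use assms in \<open>auto simp: integral_spacing_dv intro!: continuous_intros\<close>)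
  then show ?thesis by simp
qed

lemma integral_spacing_cv:
  assumes "0 < a" "0 < b" "b < 1" "0 < x" "x < 1"
  shows "(\<integral>c. \<integral>v. spacing a b c x v \<partial>unif \<partial>unif) = of_bool (a < b \<and> b < x) * (24 * (a / b) * (x - b))"
proof (cases "a < b \<and> b < x")
  case True
  have "(\<integral>c. \<integral>v. spacing a b c x v \<partial>unif \<partial>unif) = 24 * (a / b) * x - 24 * (a / b) * b"
    by (rule integral_unif_eqI[where l = b and r = x and F = "\<lambda>c. 24 * (a / b) * c" and f = "\<lambda>_. 24 * (a / b)"])
       (use True assms in \<open>auto simp: integral_spacing_v intro!: continuous_intros derivative_eq_intros\<close>)
  also have "\<dots> = of_bool (a < b \<and> b < x) * (24 * (a / b) * (x - b))"
    using True by (simp add: right_diff_distrib)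
  finally show ?thesis .
next
  case False
  then have "of_bool (a < b \<and> b < c \<and> c < x) = (0 :: real)" for c by auto
  then have "(\<integral>v. spacing a b c x v \<partial>unif) = 0" for c
    by (simp only: integral_spacing_v[OF assms(1,2)] mult_zero_left)
  then show ?thesis using False by auto
qed

lemma integral_spacing_d:
  assumes "0 < c" "c < 1"
  shows "(\<integral>d. spacing a b c d x \<partial>unif) = of_bool (a < b \<and> b < c \<and> x * b < a) * (24 * (1 - c))"
proof (cases "a < b \<and> b < c \<and> x * b < a")
  case True
  have "(\<integral>d. spacing a b c d x \<partial>unif) = 24 * 1 - 24 * c"
    by (rule integral_unif_eqI[where l = c and r = 1 and F = "\<lambda>d. 24 * d" and f = "\<lambda>_. 24"])
       (use True assms in \<open>auto simp: spacing_def intro!: continuous_intros derivative_eq_intros\<close>)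
  then show ?thesis using True by simp
qed (auto simp: spacing_def)

lemma integral_spacing_cd:
  assumes "0 < b" "b < 1"
  shows "(\<integral>c. \<integral>d. spacing a b c d x \<partial>unif \<partial>unif) = of_bool (a < b \<and> x * b < a) * (12 * (1 - b)\<^sup>2)"
proof -
  let ?i = "of_bool (a < b \<and> x * b < a) :: real"
  have "(\<integral>c. \<integral>d. spacing a b c d x \<partial>unif \<partial>unif) = ?i * (- 12 * (1 - 1)\<^sup>2) - ?i * (- 12 * (1 - b)\<^sup>2)"
    by (rule integral_unif_eqI[where l = b and r = 1 and F = "\<lambda>c. ?i * (- 12 * (1 - c)\<^sup>2)" and f = "\<lambda>c. ?i * (24 * (1 - c))"])
       (use assms in \<open>auto simp: integral_spacing_d intro!: continuous_intros derivative_eq_intros\<close>)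
  then show ?thesis by simp
qed

text \<open>
  The five projections of the kernel. Only the first one has a logarithm: there the second smallest
  variable \<open>b\<close> is integrated against \<open>1 / b\<close>.
\<close>

lemma integral_spacing_smallest:
  assumes "0 < x" "x < 1"
  shows "(\<integral>b. \<integral>c. \<integral>d. \<integral>v. spacing x b c d v \<partial>unif \<partial>unif \<partial>unif \<partial>unif)
    = - 12 * x * ln x - 18 * x + 24 * x\<^sup>2 - 6 * x ^ 3"
proof -
  let ?F = "\<lambda>b. 12 * x * (ln b - 2 * b + b\<^sup>2 / 2)"
  have "(\<integral>b. \<integral>c. \<integral>d. \<integral>v. spacing x b c d v \<partial>unif \<partial>unif \<partial>unif \<partial>unif) = ?F 1 - ?F x"
  proof (rule integral_unif_eqI[where l = x and r = 1 and F = ?F and f = "\<lambda>b. 12 * (x / b) * (1 - b)\<^sup>2"])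
    show "continuous_on {x..1} ?F" using assms by (intro continuous_intros) auto
    show "(?F has_real_derivative 12 * (x / b) * (1 - b)\<^sup>2) (at b)" if "x < b" "b < 1" for b
      using that assms by (auto intro!: derivative_eq_intros simp: field_simps power2_eq_square)
  qed (use assms in \<open>auto simp: integral_spacing_cdv\<close>)
  then show ?thesis by (simp add: algebra_simps power2_eq_square power3_eq_cube)
qed

lemma integral_spacing_second:
  assumes "0 < x" "x < 1"
  shows "(\<integral>a. \<integral>c. \<integral>d. \<integral>v. spacing a x c d v \<partial>unif \<partial>unif \<partial>unif \<partial>unif) = 6 * x * (1 - x)\<^sup>2"
proof -
  let ?F = "\<lambda>a. 6 * (a\<^sup>2 / x) * (1 - x)\<^sup>2"
  have "(\<integral>a. \<integral>c. \<integral>d. \<integral>v. spacing a x c d v \<partial>unif \<partial>unif \<partial>unif \<partial>unif) = ?F x - ?F 0"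
    by (rule integral_unif_eqI[where l = 0 and r = x and F = ?F and f = "\<lambda>a. 12 * (a / x) * (1 - x)\<^sup>2"])
       (use assms in \<open>auto simp: integral_spacing_cdv intro!: continuous_intros derivative_eq_intros\<close>)
  then show ?thesis using assms by (simp add: power2_eq_square)
qed

lemma integral_spacing_third:
  assumes "0 < x" "x < 1"
  shows "(\<integral>b. \<integral>a. \<integral>d. \<integral>v. spacing a b x d v \<partial>unif \<partial>unif \<partial>unif \<partial>unif) = 6 * x\<^sup>2 * (1 - x)"
proof -
  have inner: "(\<integral>a. \<integral>d. \<integral>v. spacing a b x d v \<partial>unif \<partial>unif \<partial>unif) = of_bool (b < x) * (12 * b * (1 - x))"
    if "0 < b" "b < 1" for b
  proof -
    let ?F = "\<lambda>a. of_bool (b < x) * (12 * (a\<^sup>2 / b) * (1 - x))"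
    have "(\<integral>a. \<integral>d. \<integral>v. spacing a b x d v \<partial>unif \<partial>unif \<partial>unif) = ?F b - ?F 0"
      by (rule integral_unif_eqI[where l = 0 and r = b and F = ?F and f = "\<lambda>a. of_bool (b < x) * (24 * (a / b) * (1 - x))"])
         (use assms that in \<open>auto simp: integral_spacing_dv intro!: continuous_intros derivative_eq_intros\<close>)
    then show ?thesis using that by (simp add: power2_eq_square)
  qed
  have "(\<integral>b. \<integral>a. \<integral>d. \<integral>v. spacing a b x d v \<partial>unif \<partial>unif \<partial>unif \<partial>unif)
      = 6 * x\<^sup>2 * (1 - x) - 6 * 0\<^sup>2 * (1 - x)"
    by (rule integral_unif_eqI[where l = 0 and r = x and F = "\<lambda>b. 6 * b\<^sup>2 * (1 - x)" and f = "\<lambda>b. 12 * b * (1 - x)"])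
       (use assms in \<open>auto simp: inner intro!: continuous_intros derivative_eq_intros\<close>)
  then show ?thesis by simp
qed

lemma integral_spacing_largest:
  assumes "0 < x" "x < 1"
  shows "(\<integral>b. \<integral>a. \<integral>c. \<integral>v. spacing a b c x v \<partial>unif \<partial>unif \<partial>unif \<partial>unif) = 2 * x ^ 3"
proof -
  have inner: "(\<integral>a. \<integral>c. \<integral>v. spacing a b c x v \<partial>unif \<partial>unif \<partial>unif) = of_bool (b < x) * (12 * b * (x - b))"
    if "0 < b" "b < 1" for b
  proof -
    let ?F = "\<lambda>a. of_bool (b < x) * (12 * (a\<^sup>2 / b) * (x - b))"
    have "(\<integral>a. \<integral>c. \<integral>v. spacing a b c x v \<partial>unif \<partial>unif \<partial>unif) = ?F b - ?F 0"
      by (rule integral_unif_eqI[where l = 0 and r = b and F = ?F and f = "\<lambda>a. of_bool (b < x) * (24 * (a / b) * (x - b))"])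
         (use assms that in \<open>auto simp: integral_spacing_cv intro!: continuous_intros derivative_eq_intros\<close>)
    then show ?thesis using that by (simp add: power2_eq_square)
  qed
  have "(\<integral>b. \<integral>a. \<integral>c. \<integral>v. spacing a b c x v \<partial>unif \<partial>unif \<partial>unif \<partial>unif)
      = (6 * x * x\<^sup>2 - 4 * x ^ 3) - (6 * x * 0\<^sup>2 - 4 * 0 ^ 3)"
    by (rule integral_unif_eqI[where l = 0 and r = x and F = "\<lambda>b. 6 * x * b\<^sup>2 - 4 * b ^ 3" and f = "\<lambda>b. 12 * b * (x - b)"])
       (use assms in \<open>auto simp: inner algebra_simps power2_eq_square intro!: continuous_intros derivative_eq_intros\<close>)
  then show ?thesis by (simp add: power2_eq_square power3_eq_cube)
qed

lemma integral_spacing_ratio: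
  assumes "0 < x" "x < 1"
  shows "(\<integral>b. \<integral>a. \<integral>c. \<integral>d. spacing a b c d x \<partial>unif \<partial>unif \<partial>unif \<partial>unif) = 1 - x"
proof -
  have inner: "(\<integral>a. \<integral>c. \<integral>d. spacing a b c d x \<partial>unif \<partial>unif \<partial>unif) = 12 * b * (1 - x) * (1 - b)\<^sup>2"
    if b: "0 < b" "b < 1" for b
  proof -
    have "0 < x * b" "x * b < b" using assms b by auto
    then have "(\<integral>a. \<integral>c. \<integral>d. spacing a b c d x \<partial>unif \<partial>unif \<partial>unif)
        = 12 * (1 - b)\<^sup>2 * b - 12 * (1 - b)\<^sup>2 * (x * b)"
      by (intro integral_unif_eqI[where l = "x * b" and r = b and F = "\<lambda>a. 12 * (1 - b)\<^sup>2 * a" and f = "\<lambda>a. 12 * (1 - b)\<^sup>2"])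
         (use assms b in \<open>auto simp: integral_spacing_cd intro!: continuous_intros derivative_eq_intros\<close>)
    then show ?thesis by (simp add: algebra_simps)
  qed
  let ?F = "\<lambda>b. (1 - x) * (6 * b\<^sup>2 - 8 * b ^ 3 + 3 * b ^ 4)"
  have "(\<integral>b. \<integral>a. \<integral>c. \<integral>d. spacing a b c d x \<partial>unif \<partial>unif \<partial>unif \<partial>unif) = ?F 1 - ?F 0"
  proof (rule integral_unif_eqI[where l = 0 and r = 1 and F = ?F and f = "\<lambda>b. 12 * b * (1 - x) * (1 - b)\<^sup>2"])
    show "(?F has_real_derivative 12 * b * (1 - x) * (1 - b)\<^sup>2) (at b)" for b
      by (rule derivative_eq_intros refl | simp)+ (simp add: algebra_simps power2_eq_square power3_eq_cube)
  qed (use assms in \<open>auto simp: inner intro!: continuous_intros\<close>)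
  then show ?thesis by simp
qed

section \<open>Projections, variance and the limit law\<close>

lemma continuous_on_mult_ln: "continuous_on {0..} (\<lambda>x::real. x * ln x)"
  unfolding continuous_on_eq_continuous_within
proof
  fix x :: real assume x: "x \<in> {0..}"
  show "continuous (at x within {0..}) (\<lambda>x. x * ln x)"
  proof (cases "x = 0")
    case True
    have "((\<lambda>y::real. - (ln y / y)) \<longlongrightarrow> 0) at_top"
      using tendsto_minus[OF ln_x_over_x_tendsto_0] by simp
    then have "((\<lambda>y::real. inverse y * ln (inverse y)) \<longlongrightarrow> 0) at_top"
      by (rule Lim_transform_eventually)
         (auto simp: eventually_at_top_linorder ln_inverse divide_inverse mult.commute intro!: exI[of _ 1])
    then have "((\<lambda>x::real. x * ln x) \<longlongrightarrow> 0) (at_right 0)"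
      by (simp add: filterlim_at_right_to_top)
    then show ?thesis
      using True by (simp add: continuous_within at_within_Ici_at_right)
  next
    case False
    with x show ?thesis by (auto intro!: continuous_intros)
  qed
qed

text \<open>
  The sum of the five projections of the kernel, centred: each projection has mean \<open>1 / 2\<close>, and only the
  last one has a constant term, whence \<open>1 - 5 / 2 = - 3 / 2\<close>.
\<close>

definition spacing_proj :: "real \<Rightarrow> real" where
  "spacing_proj x = - 12 * x * ln x - 13 * x + 18 * x\<^sup>2 - 4 * x ^ 3 - 3 / 2"

context
  fixes M :: "'a measure" and U :: "nat \<Rightarrow> 'a \<Rightarrow> real"
  assumes iid: "iid_sample M U unif"
begin

interpretation iid_sample M U unif by (rule iid)

lemma kernel_proj_spacing:
  assumes x: "0 < x" "x < 1"
  shows "kernel_proj 5 spacing_kernel 0 x = - 12 * x * ln x - 18 * x + 24 * x\<^sup>2 - 6 * x ^ 3"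
    and "kernel_proj 5 spacing_kernel 1 x = 6 * x * (1 - x)\<^sup>2"
    and "kernel_proj 5 spacing_kernel 2 x = 6 * x\<^sup>2 * (1 - x)"
    and "kernel_proj 5 spacing_kernel 3 x = 2 * x ^ 3"
    and "kernel_proj 5 spacing_kernel 4 x = 1 - x"
proof -
  have meas: "(\<lambda>y. spacing_kernel (y(j := x))) \<in> borel_measurable (law_power 5)" if "j < 5" for j
    by (rule measurable_compose[OF measurable_fun_upd_law_power spacing_kernel_measurable])
       (use that in auto)
  have eq: "kernel_proj 5 spacing_kernel j x =
    (\<integral>b. (\<integral>a. (\<integral>c. (\<integral>d. (\<integral>v. spacing_kernel ((\<lambda>_. undefined)(1 := b, 0 := a, 2 := c, 3 := d, 4 := v, j := x))
      \<partial>unif) \<partial>unif) \<partial>unif) \<partial>unif) \<partial>unif)" if "j < 5" for j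
    unfolding kernel_proj_def by (rule integral_unif_5[OF meas[OF that] abs_spacing_kernel_le])
  note const = unif.prob_space
  show "kernel_proj 5 spacing_kernel 0 x = - 12 * x * ln x - 18 * x + 24 * x\<^sup>2 - 6 * x ^ 3"
    using integral_spacing_smallest[OF x] by (simp add: eq spacing_kernel_def const)
  show "kernel_proj 5 spacing_kernel 1 x = 6 * x * (1 - x)\<^sup>2"
    using integral_spacing_second[OF x] by (simp add: eq spacing_kernel_def const)
  show "kernel_proj 5 spacing_kernel 2 x = 6 * x\<^sup>2 * (1 - x)"
    using integral_spacing_third[OF x] by (simp add: eq spacing_kernel_def const)
  show "kernel_proj 5 spacing_kernel 3 x = 2 * x ^ 3"
    using integral_spacing_largest[OF x] by (simp add: eq spacing_kernel_def const)
  show "kernel_proj 5 spacing_kernel 4 x = 1 - x"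
    using integral_spacing_ratio[OF x] by (simp add: eq spacing_kernel_def const)
qed

lemma kernel_mean_spacing: "kernel_mean 5 spacing_kernel = 1 / 2"
proof -
  have "kernel_mean 5 spacing_kernel = (\<integral>x. kernel_proj 5 spacing_kernel 4 x \<partial>unif)"
    by (rule integral_kernel_proj[OF spacing_kernel_measurable abs_spacing_kernel_le, symmetric]) simp
  also have "\<dots> = (1 - 1\<^sup>2 / 2) - (0 - 0\<^sup>2 / 2)"
  proof (rule integral_unif_eqI[where l = 0 and r = 1 and f = "\<lambda>x. 1 - x" and F = "\<lambda>x. x - x\<^sup>2 / 2"])
    show "kernel_proj 5 spacing_kernel 4 \<in> borel_measurable borel"
      using kernel_proj_measurable[OF spacing_kernel_measurable, of 4]
      by (simp add: measurable_cong_sets[OF sets_unif refl])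
  qed (auto simp: kernel_proj_spacing intro!: continuous_intros derivative_eq_intros)
  finally show ?thesis by simp
qed

lemma hajek_proj_spacing:
  assumes "0 < x" "x < 1"
  shows "hajek_proj 5 spacing_kernel x = spacing_proj x"
proof -
  have I: "{..<5::nat} = {0, 1, 2, 3, 4}" by auto
  let ?p = "\<lambda>j. kernel_proj 5 spacing_kernel j x - 1 / 2"
  have "hajek_proj 5 spacing_kernel x = (\<Sum>j\<in>{0, 1, 2, 3, 4}. ?p j)"
    unfolding hajek_proj_def I kernel_mean_spacing ..
  also have "\<dots> = ?p 0 + ?p 1 + ?p 2 + ?p 3 + ?p 4" by simp
  also have "\<dots> = spacing_proj x"
    unfolding kernel_proj_spacing[OF assms] spacing_proj_def
    by (simp add: algebra_simps power2_eq_square power3_eq_cube)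
  finally show ?thesis .
qed

text \<open>
  The antiderivative is a polynomial \<open>G\<close> in \<open>x\<close> and \<open>q = x * ln x\<close>. In these variables it is
  visibly continuous at 0, where \<open>ln\<close> is not.
\<close>

lemma integral_hajek_proj_spacing_sq: "(\<integral>x. (hajek_proj 5 spacing_kernel x)\<^sup>2 \<partial>unif) = 271 / 2100"
proof -
  define G where "G = (\<lambda>x q :: real. 48 * x * q\<^sup>2 + (96 / 5 * x ^ 4 - 108 * x ^ 3 + 72 * x\<^sup>2 + 18 * x) * q
    + (16 / 7 * x ^ 7 - 24 * x ^ 6 + 2044 / 25 * x ^ 5 - 87 * x ^ 4 + 43 / 3 * x ^ 3 + 21 / 2 * x\<^sup>2 + 9 / 4 * x))"
  define F where "F = (\<lambda>x. G x (x * ln x))"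
  have G_cont: "continuous_on {0..1} (\<lambda>x. G x (q x))" if "continuous_on {0..1} q" for q
    unfolding G_def by (intro continuous_intros that)
  define G' where "G' = (\<lambda>x q q' :: real. 48 * q\<^sup>2 + 96 * x * q * q'
    + (96 / 5 * x ^ 4 - 108 * x ^ 3 + 72 * x\<^sup>2 + 18 * x) * q'
    + (384 / 5 * x ^ 3 - 324 * x\<^sup>2 + 144 * x + 18) * q
    + (16 * x ^ 6 - 144 * x ^ 5 + 2044 / 5 * x ^ 4 - 348 * x ^ 3 + 43 * x\<^sup>2 + 21 * x + 9 / 4))"
  have G_deriv: "((\<lambda>x. G x (q x)) has_real_derivative G' x (q x) q') (at x)"
    if "(q has_real_derivative q') (at x)" for q q' x
    unfolding G_def G'_def
    by (rule derivative_eq_intros that refl)+ (simp add: algebra_simps)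
  have "(\<integral>x. (hajek_proj 5 spacing_kernel x)\<^sup>2 \<partial>unif) = F 1 - F 0"
  proof (rule integral_unif_eqI[where l = 0 and r = 1 and F = F and f = "\<lambda>x. (spacing_proj x)\<^sup>2"])
    show "(\<lambda>x. (hajek_proj 5 spacing_kernel x)\<^sup>2) \<in> borel_measurable borel"
      using hajek_proj_measurable[OF spacing_kernel_measurable]
      by (intro borel_measurable_power) (simp add: measurable_cong_sets[OF sets_unif refl])
    have "continuous_on {0..1} (\<lambda>x::real. x * ln x)"
      by (rule continuous_on_subset[OF continuous_on_mult_ln]) auto
    then show "continuous_on {0..1} F"
      unfolding F_def by (rule G_cont)
    fix x :: real assume x: "0 < x" "x < 1"
    have q: "((\<lambda>x. x * ln x) has_real_derivative ln x + 1) (at x)"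
      using x by (auto intro!: derivative_eq_intros)
    have "(F has_real_derivative G' x (x * ln x) (ln x + 1)) (at x)"
      unfolding F_def by (rule G_deriv[OF q])
    also have "G' x (x * ln x) (ln x + 1) = (spacing_proj x)\<^sup>2"
      unfolding G'_def spacing_proj_def by algebra
    finally show "(F has_real_derivative (spacing_proj x)\<^sup>2) (at x)" .
  qed (auto simp: hajek_proj_spacing)
  also have "\<dots> = 271 / 2100" by (simp add: F_def G_def)
  finally show ?thesis .
qed

text \<open>
  Given the value of one of the two variables, the law of the other one is still uniform and has no atoms.
\<close>

lemma AE_iid_neq:
  assumes "i \<noteq> j"
  shows "AE \<omega> in M. U i \<omega> \<noteq> U j \<omega>"
proof -
  let ?R = "\<lambda>k \<omega>. restrict (\<lambda>i. U i \<omega>) {k}"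
  have ind: "indep_var (PiM {i} (\<lambda>_. unif)) (?R i) (PiM {j} (\<lambda>_. unif)) (?R j)"
    by (rule indep_var_restrict[OF indep]) (use assms in auto)
  have [measurable]: "U k \<in> borel_measurable M" for k
    using X_measurable[of k] by (simp add: measurable_cong_sets[OF refl sets_unif])
  have zero: "(\<integral>y. of_bool (s = y) \<partial>unif) = (0 :: real)" for s :: real
  proof -
    have "AE y in lborel. y \<noteq> s" by (rule AE_lborel_singleton)
    then have "AE y in unif. y \<noteq> s" by (subst AE_uniform_measure) auto
    then have "(\<integral>y. of_bool (s = y) \<partial>unif) = (\<integral>y. (0 :: real) \<partial>unif)"
      by (intro integral_cong_AE) (auto simp: of_bool_def)
    then show ?thesis by simp
  qed
  have [measurable]: "(\<lambda>y. y k) \<in> borel_measurable (PiM {k} (\<lambda>_. unif))" for k :: nat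
    using measurable_component_singleton[of k "{k}" "\<lambda>_. unif"] by simp
  let ?f = "\<lambda>p. of_bool (fst p i = snd p j) :: real"
  have "expectation (\<lambda>\<omega>. ?f (?R i \<omega>, ?R j \<omega>)) = 0"
  proof (rule expectation_eq_0_of_frozen[OF ind])
    show "?f \<in> borel_measurable (PiM {i} (\<lambda>_. unif) \<Otimes>\<^sub>M PiM {j} (\<lambda>_. unif))"
      unfolding of_bool_def by measurable
    show "\<bar>?f p\<bar> \<le> 1" for p by simp
    fix a :: "nat \<Rightarrow> real"
    have "expectation (\<lambda>\<omega>. ?f (a, ?R j \<omega>)) = (\<integral>y. of_bool (a i = y) \<partial>distr M unif (U j))"
      by (subst integral_distr) (auto simp: of_bool_def)
    then show "expectation (\<lambda>\<omega>. ?f (a, ?R j \<omega>)) = 0" by (simp only: law zero)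
  qed
  then have E: "expectation (\<lambda>\<omega>. of_bool (U i \<omega> = U j \<omega>) :: real) = 0" by simp
  have [measurable]: "(\<lambda>\<omega>. of_bool (U i \<omega> = U j \<omega>) :: real) \<in> borel_measurable M"
    unfolding of_bool_def by measurable
  have "integrable M (\<lambda>\<omega>. of_bool (U i \<omega> = U j \<omega>) :: real)"
    by (rule integrable_const_bound[of _ 1]) auto
  from integral_nonneg_eq_0_iff_AE[OF this] E
  have "AE \<omega> in M. of_bool (U i \<omega> = U j \<omega>) = (0 :: real)" by simp
  then show ?thesis by eventually_elim simp
qed

end

lemma powr_neg_le_iff:
  fixes a x y :: real
  assumes "0 < a" "0 < x" "0 < y"
  shows "x powr - a \<le> y powr - a \<longleftrightarrow> y \<le> x"
  using assms powr_less_mono2_neg[of "- a" x y] powr_mono2'[of "- a" y x] by force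

text \<open>
  The Pareto law is the image of the uniform law under its quantile function, up to reflection. Below 1 the
  distribution function has to vanish because it is monotone and vanishes at 1.
\<close>

lemma pareto_eq_distr_unif:
  assumes D: "real_distribution D" and lam: "0 < lam"
    and cdf: "\<And>x. 1 \<le> x \<Longrightarrow> cdf D x = 1 - x powr - lam"
  shows "D = distr unif borel (\<lambda>v. v powr (- 1 / lam))"
proof (rule cdf_unique[OF D])
  interpret D: real_distribution D by fact
  let ?q = "\<lambda>v. v powr (- 1 / lam)"
  have [measurable]: "?q \<in> borel_measurable unif" by measurable
  show "real_distribution (distr unif borel ?q)" by (rule unif.real_distribution_distr) simp
  show "cdf D = cdf (distr unif borel ?q)"
  proof
    fix x
    have q: "0 < ?q v" "?q v powr - lam = v" if "0 < v" for v
      using that lam by (simp_all add: powr_powr)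
    have m: "cdf (distr unif borel ?q) x = measure unif {v. ?q v \<le> x}"
      by (simp add: cdf_def measure_distr vimage_def)
    show "cdf D x = cdf (distr unif borel ?q) x"
    proof (cases "1 \<le> x")
      case True
      then have p: "0 \<le> x powr - lam" "x powr - lam \<le> 1"
        using lam powr_neg_le_iff[of lam x 1] by auto
      have "measure unif {v. ?q v \<le> x} = measure unif {x powr - lam..1}"
      proof (rule unif.finite_measure_eq_AE)
        show "AE v in unif. v \<in> {v. ?q v \<le> x} \<longleftrightarrow> v \<in> {x powr - lam..1}"
          using AE_unif
        proof eventually_elim
          fix v :: real assume v: "0 < v \<and> v < 1"
          then have "?q v \<le> x \<longleftrightarrow> x powr - lam \<le> v"
            using powr_neg_le_iff[of lam x "?q v"] q[of v] lam True by simp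
          then show "v \<in> {v. ?q v \<le> x} \<longleftrightarrow> v \<in> {x powr - lam..1}" using v by auto
        qed
      qed auto
      also have "\<dots> = 1 - x powr - lam" using p by (simp add: max_absorb2)
      finally show ?thesis using cdf[OF True] m by simp
    next
      case False
      have "cdf D x \<le> cdf D 1" using False by (intro D.cdf_nondecreasing) simp
      then have "cdf D x = 0" using cdf[of 1] D.cdf_nonneg[of x] by simp
      moreover have "measure unif {v. ?q v \<le> x} = measure unif {}"
      proof (rule unif.finite_measure_eq_AE)
        show "AE v in unif. v \<in> {v. ?q v \<le> x} \<longleftrightarrow> v \<in> {}"
          using AE_unif
        proof eventually_elim
          fix v :: real assume v: "0 < v \<and> v < 1"
          then have "1 < ?q v" using powr_neg_le_iff[of "1 / lam" v 1] lam by (simp add: not_le[symmetric])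
          then show "v \<in> {v. ?q v \<le> x} \<longleftrightarrow> v \<in> {}" using False by auto
        qed
      qed auto
      ultimately show ?thesis using m by simp
    qed
  qed
qed

lemma distr_pareto_powr:
  assumes lam: "0 < lam"
  shows "distr (distr unif borel (\<lambda>v. v powr (- 1 / lam))) borel (\<lambda>x. x powr - lam) = unif"
proof -
  have "distr (distr unif borel (\<lambda>v. v powr (- 1 / lam))) borel (\<lambda>x. x powr - lam)
      = distr unif borel (\<lambda>v. (v powr (- 1 / lam)) powr - lam)"
    by (subst distr_distr) (auto simp: o_def)
  also have "\<dots> = distr unif borel (\<lambda>v. v)"
  proof (rule distr_cong_AE)
    show "AE v in unif. (v powr (- 1 / lam)) powr - lam = v"
      using AE_unif by eventually_elim (use lam in \<open>simp add: powr_powr\<close>)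
  qed auto
  also have "\<dots> = unif" by (rule distr_id2) simp
  finally show ?thesis .
qed

text \<open>
  Passing to \<open>U\<^sub>i = X\<^sub>i powr - lam\<close> removes the parameter; on the almost sure event that there are no ties the
  statistic is within \<open>100 / n\<close> of a centred U-statistic of uniform variables, whose limit is known.
\<close>

theorem theorem4:
  fixes M :: "'a measure" and X :: "nat \<Rightarrow> 'a \<Rightarrow> real" and lam :: real
  assumes "prob_space M"
    and "prob_space.indep_vars M (\<lambda>_. borel) X UNIV"
    and "lam > 0"
    and "\<And>i x. x \<ge> 1 \<Longrightarrow> cdf (distr M borel (X i)) x = 1 - x powr (- lam)"
  shows "weak_conv_m
           (\<lambda>n. distr M borel (\<lambda>\<omega>. sqrt (real n) * I4_stat n (\<lambda>i. X i \<omega>)))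
           (density lborel (normal_density 0 (sqrt (271 / 2100))))"
proof -
  interpret prob_space M by fact
  have X [measurable]: "X i \<in> borel_measurable M" for i
    using assms(2) by (auto simp: indep_vars_def)
  define U where "U = (\<lambda>i \<omega>. X i \<omega> powr - lam)"
  have law_X: "distr M borel (X i) = distr unif borel (\<lambda>v. v powr (- 1 / lam))" for i
    by (rule pareto_eq_distr_unif[OF real_distribution_distr assms(3) assms(4)]) simp_all
  have iid: "iid_sample M U unif"
  proof
    show "indep_vars (\<lambda>_. unif) U UNIV"
      unfolding U_def by (rule indep_vars_compose2[OF assms(2)]) measurable
    fix i
    have "distr M unif (U i) = distr M borel (U i)" by (rule distr_cong) auto
    also have "\<dots> = distr (distr M borel (X i)) borel (\<lambda>x. x powr - lam)"
      unfolding U_def by (subst distr_distr) (auto simp: o_def)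
    also have "\<dots> = unif" unfolding law_X by (rule distr_pareto_powr[OF assms(3)])
    finally show "distr M unif (U i) = unif" .
  qed
  interpret S: iid_sample M U unif by (rule iid)
  have pos: "AE \<omega> in M. 0 < X i \<omega>" for i
  proof -
    have "AE v in unif. 0 < v powr (- 1 / lam)" using AE_unif by eventually_elim simp
    then have "AE x in distr M borel (X i). 0 < x" unfolding law_X by (subst AE_distr_iff) auto
    then show ?thesis by (subst (asm) AE_distr_iff) auto
  qed
  have neq: "AE \<omega> in M. i \<noteq> j \<longrightarrow> U i \<omega> \<noteq> U j \<omega>" for i j
    using AE_iid_neq[OF iid, of i j] by (cases "i = j") auto
  let ?A = "\<lambda>n \<omega>. sqrt (real n) * I4_stat n (\<lambda>i. X i \<omega>)"
  let ?B = "\<lambda>n \<omega>. sqrt (real n) * (S.U_stat 5 spacing_kernel n \<omega> - 1 / 2)"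
  have approx: "AE \<omega> in M. \<bar>?A n \<omega> - ?B n \<omega>\<bar> \<le> 100 / sqrt (real n)" if n: "5 \<le> n" for n
  proof -
    have "AE \<omega> in M. \<forall>i. 0 < X i \<omega>" using pos by (simp add: AE_all_countable)
    moreover have "AE \<omega> in M. \<forall>i j. i \<noteq> j \<longrightarrow> U i \<omega> \<noteq> U j \<omega>" using neq by (simp add: AE_all_countable)
    ultimately show ?thesis
    proof eventually_elim
      fix \<omega> assume p: "\<forall>i. 0 < X i \<omega>" and d: "\<forall>i j. i \<noteq> j \<longrightarrow> U i \<omega> \<noteq> U j \<omega>"
      have inj: "inj_on (\<lambda>i. X i \<omega>) {..<n}" using d unfolding inj_on_def U_def by metis
      have "\<bar>I4_stat n (\<lambda>i. X i \<omega>) - (S.U_stat 5 spacing_kernel n \<omega> - 1 / 2)\<bar> \<le> 100 / real n"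
        unfolding S.U_stat_def
        by (rule I4_stat_approx[OF assms(3) _ inj _ n]) (use p in \<open>auto simp: U_def\<close>)
      then have "sqrt (real n) * \<bar>I4_stat n (\<lambda>i. X i \<omega>) - (S.U_stat 5 spacing_kernel n \<omega> - 1 / 2)\<bar>
          \<le> sqrt (real n) * (100 / real n)"
        by (rule mult_left_mono) simp
      moreover have "sqrt (real n) * (100 / real n) = 100 / sqrt (real n)"
        using n by (simp add: field_simps)
      moreover have "?A n \<omega> - ?B n \<omega> = sqrt (real n) * (I4_stat n (\<lambda>i. X i \<omega>) - (S.U_stat 5 spacing_kernel n \<omega> - 1 / 2))"
        by (simp add: algebra_simps)
      ultimately show "\<bar>?A n \<omega> - ?B n \<omega>\<bar> \<le> 100 / sqrt (real n)"
        by (simp add: abs_mult)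
    qed
  qed
  have A_meas [measurable]: "?A n \<in> borel_measurable M" for n
    by (intro borel_measurable_times borel_measurable_const borel_measurable_I4_stat X)
  have B_meas [measurable]: "?B n \<in> borel_measurable M" for n
    using S.U_stat_measurable[OF spacing_kernel_measurable, of n] by measurable
  have int: "integrable M (\<lambda>\<omega>. \<bar>?A n \<omega> - ?B n \<omega>\<bar>)" if "5 \<le> n" for n
    by (rule integrable_const_bound[of _ "100 / sqrt (real n)"]) (use approx[OF that] in auto)
  show ?thesis
  proof (rule weak_conv_of_expectation_diff_tendsto_zero[where B = ?B])
    show "eventually (\<lambda>n. integrable M (\<lambda>\<omega>. \<bar>?A n \<omega> - ?B n \<omega>\<bar>)) sequentially"
      using int by (rule eventually_sequentiallyI)
    have bound: "norm (expectation (\<lambda>\<omega>. \<bar>?A n \<omega> - ?B n \<omega>\<bar>)) \<le> 100 / sqrt (real n)" if "5 \<le> n" for n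
      using integral_le_const[OF int[OF that] approx[OF that]] by simp
    have lim: "(\<lambda>n. 100 / sqrt (real n)) \<longlonglongrightarrow> 0"
      by (intro tendsto_divide_0[OF tendsto_const] filterlim_at_top_imp_at_infinity
          filterlim_compose[OF sqrt_at_top filterlim_real_sequentially])
    show "(\<lambda>n. expectation (\<lambda>\<omega>. \<bar>?A n \<omega> - ?B n \<omega>\<bar>)) \<longlonglongrightarrow> 0"
      by (rule Lim_null_comparison[OF eventually_sequentiallyI[OF bound] lim])
    show "weak_conv_m (\<lambda>n. distr M borel (?B n)) (density lborel (normal_density 0 (sqrt (271 / 2100))))"
      using S.U_stat_clt[OF spacing_kernel_measurable abs_spacing_kernel_le, of "sqrt (271 / 2100)"]
      by (simp add: kernel_mean_spacing[OF iid] integral_hajek_proj_spacing_sq[OF iid])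
  qed (auto intro: real_distribution_normal A_meas B_meas)
qed

end
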